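(* The model checking problem for $\mathsf{KC}^{\Rightarrow}$ is $\mathsf{P}$-hard (under logspace many-one reductions).
   Context: Intuitionistic formulas: $\varphi ::= \bot \mid p \mid \varphi\wedge\varphi \mid \varphi\vee\varphi \mid \varphi\Rightarrow\varphi$, $p$ from a countable set of variables. A model for $\mathsf{KC}$ is a triple $(U,\triangleleft,\xi)$ with $U$ finite nonempty, $\triangleleft$ reflexive and transitive and directed (for all $a,b\in U$ there is $c$ with $a\triangleleft c$ and $b\triangleleft c$), and $\xi$ a valuation that is monotone ($a\in\xi(p)$, $a\triangleleft b$ imply $b\in\xi(p)$). Satisfaction: $s\not\models\bot$; $s\models p$ iff $s\in\xi(p)$; $\wedge,\vee$ pointwise; $s\models\varphi\Rightarrow\psi$ iff for all $n$ with $s\triangleleft n$, $n\models\varphi$ implies $n\models\psi$. $\mathsf{KC}^{\Rightarrow}$ denotes the implicational formulas (built from $\bot$, variables and $\Rightarrow$ only). The model checking problem: given an implicational formula $\varphi$, a finite $\mathsf{KC}$ model $\mathfrak{M}$ and a state $s$, decide whether $\mathfrak{M},s\models\varphi$. *)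

theory Defs
  imports Complex_Main "HOL-Library.Landau_Symbols"
begin

section \<open>Intuitionistic formulas and models for KC\<close>

datatype fml =
    Bot
  | Var nat
  | Conj fml fml
  | Disj fml fml
  | Imp fml fml

primrec implicational :: "fml \<Rightarrow> bool" where
  "implicational Bot \<longleftrightarrow> True"
| "implicational (Var p) \<longleftrightarrow> True"
| "implicational (Conj \<phi> \<psi>) \<longleftrightarrow> False"
| "implicational (Disj \<phi> \<psi>) \<longleftrightarrow> False"
| "implicational (Imp \<phi> \<psi>) \<longleftrightarrow> implicational \<phi> \<and> implicational \<psi>"

primrec vars :: "fml \<Rightarrow> nat set" where
  "vars Bot = {}"
| "vars (Var p) = {p}"
| "vars (Conj \<phi> \<psi>) = vars \<phi> \<union> vars \<psi>"
| "vars (Disj \<phi> \<psi>) = vars \<phi> \<union> vars \<psi>"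
| "vars (Imp \<phi> \<psi>) = vars \<phi> \<union> vars \<psi>"

record 'w model =
  worlds :: "'w set"
  acc :: "('w \<times> 'w) set"
  val :: "nat \<Rightarrow> 'w set"

definition KC_model :: "'w model \<Rightarrow> bool" where
  "KC_model M \<longleftrightarrow>
     finite (worlds M) \<and> worlds M \<noteq> {} \<and>
     acc M \<subseteq> worlds M \<times> worlds M \<and> refl_on (worlds M) (acc M) \<and> trans (acc M) \<and>
     (\<forall>a\<in>worlds M. \<forall>b\<in>worlds M. \<exists>c\<in>worlds M. (a, c) \<in> acc M \<and> (b, c) \<in> acc M) \<and>
     (\<forall>p. val M p \<subseteq> worlds M) \<and>
     (\<forall>p a b. a \<in> val M p \<longrightarrow> (a, b) \<in> acc M \<longrightarrow> b \<in> val M p)"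

primrec sat :: "'w model \<Rightarrow> 'w \<Rightarrow> fml \<Rightarrow> bool" where
  "sat M s Bot \<longleftrightarrow> False"
| "sat M s (Var p) \<longleftrightarrow> s \<in> val M p"
| "sat M s (Conj \<phi> \<psi>) \<longleftrightarrow> sat M s \<phi> \<and> sat M s \<psi>"
| "sat M s (Disj \<phi> \<psi>) \<longleftrightarrow> sat M s \<phi> \<or> sat M s \<psi>"
| "sat M s (Imp \<phi> \<psi>) \<longleftrightarrow> (\<forall>n. (s, n) \<in> acc M \<longrightarrow> sat M n \<phi> \<longrightarrow> sat M n \<psi>)"


section \<open>The model checking problem as a language\<close>

type_synonym language = "bool list set"

text \<open>
  Formulas are written in prefix notation and numbers in unary. A model with worlds
  \<open>{..<n}\<close> is given by its adjacency matrix and, for each of the variables \<open>0, \<dots>, m - 1\<close>,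
  the characteristic vector of its valuation. As these tables have \<open>n * n\<close> and \<open>m * n\<close>
  entries, unary notation changes the length only polynomially.
\<close>

definition enc_nat :: "nat \<Rightarrow> bool list" where
  "enc_nat n = replicate n True @ [False]"

primrec enc_fml :: "fml \<Rightarrow> bool list" where
  "enc_fml Bot = [False, False, False]"
| "enc_fml (Var p) = [False, False, True] @ enc_nat p"
| "enc_fml (Conj \<phi> \<psi>) = [False, True, False] @ enc_fml \<phi> @ enc_fml \<psi>"
| "enc_fml (Disj \<phi> \<psi>) = [False, True, True] @ enc_fml \<phi> @ enc_fml \<psi>"
| "enc_fml (Imp \<phi> \<psi>) = [True, False, False] @ enc_fml \<phi> @ enc_fml \<psi>"

definition enc_table :: "nat \<Rightarrow> nat \<Rightarrow> (nat \<Rightarrow> nat \<Rightarrow> bool) \<Rightarrow> bool list" where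
  "enc_table r c f = concat (map (\<lambda>i. map (f i) [0..<c]) [0..<r])"

definition enc_instance :: "fml \<Rightarrow> nat \<Rightarrow> nat \<Rightarrow> nat model \<Rightarrow> nat \<Rightarrow> bool list" where
  "enc_instance \<phi> n m M s =
     enc_fml \<phi> @
     enc_nat n @ enc_table n n (\<lambda>a b. (a, b) \<in> acc M) @
     enc_nat m @ enc_table m n (\<lambda>p a. a \<in> val M p) @
     enc_nat s"

text \<open>
  The variables that occur in the formula must be among the tabulated ones; the valuation of
  the other variables is arbitrary and irrelevant.
\<close>

definition valid_instance :: "fml \<Rightarrow> nat \<Rightarrow> nat \<Rightarrow> nat model \<Rightarrow> nat \<Rightarrow> bool" where
  "valid_instance \<phi> n m M s \<longleftrightarrow>
     implicational \<phi> \<and> KC_model M \<and> worlds M = {..<n} \<and> vars \<phi> \<subseteq> {..<m} \<and> s \<in> worlds M"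

definition KC_imp_model_checking :: language where
  "KC_imp_model_checking =
     {enc_instance \<phi> n m M s | \<phi> n m M s. valid_instance \<phi> n m M s \<and> sat M s \<phi>}"

text \<open>The encoding is unambiguous: the language contains no encoding of a negative instance.\<close>

lemma enc_nat_append_inject: "enc_nat a @ u = enc_nat b @ v \<longleftrightarrow> a = b \<and> u = v"
proof (induction a arbitrary: b)
  case 0
  show ?case by (cases b) (auto simp: enc_nat_def)
next
  case (Suc a)
  then show ?case by (cases b) (auto simp: enc_nat_def)
qed

lemma enc_fml_append_inject: "enc_fml \<phi> @ u = enc_fml \<psi> @ v \<longleftrightarrow> \<phi> = \<psi> \<and> u = v"
proof (induction \<phi> arbitrary: \<psi> u v)
  case Bot
  show ?case by (cases \<psi>) auto
next
  case (Var p)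
  show ?case by (cases \<psi>) (auto simp: enc_nat_append_inject)
next
  case (Conj \<phi>1 \<phi>2)
  then show ?case by (cases \<psi>) auto
next
  case (Disj \<phi>1 \<phi>2)
  then show ?case by (cases \<psi>) auto
next
  case (Imp \<phi>1 \<phi>2)
  then show ?case by (cases \<psi>) auto
qed

lemma length_enc_table: "length (enc_table r c f) = r * c"
  by (simp add: enc_table_def length_concat o_def sum_list_triv)

lemma enc_table_inject:
  "enc_table r c f = enc_table r c g \<longleftrightarrow> (\<forall>i<r. \<forall>j<c. f i j = g i j)"
proof (induction r)
  case 0
  show ?case by (simp add: enc_table_def)
next
  case (Suc r)
  have "enc_table (Suc r) c h = enc_table r c h @ map (h r) [0..<c]" for h
    by (simp add: enc_table_def)
  then show ?case
    using Suc by (auto simp: length_enc_table less_Suc_eq)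
qed

lemma sat_cong:
  assumes "acc M = acc N" and "acc M \<subseteq> W \<times> W" and "s \<in> W"
    and "\<And>p a. p \<in> vars \<phi> \<Longrightarrow> a \<in> W \<Longrightarrow> a \<in> val M p \<longleftrightarrow> a \<in> val N p"
  shows "sat M s \<phi> \<longleftrightarrow> sat N s \<phi>"
  using assms
proof (induction \<phi> arbitrary: s)
  case (Imp \<phi> \<psi>)
  have "sat M n \<phi> = sat N n \<phi> \<and> sat M n \<psi> = sat N n \<psi>" if "(s, n) \<in> acc M" for n
    using Imp that by (auto simp: subset_iff)
  then show ?case using Imp.prems(1) by auto
qed auto

lemma enc_instance_in_model_checking_iff:
  assumes "valid_instance \<phi> n m M s"
  shows "enc_instance \<phi> n m M s \<in> KC_imp_model_checking \<longleftrightarrow> sat M s \<phi>"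
proof
  assume "enc_instance \<phi> n m M s \<in> KC_imp_model_checking"
  then obtain \<phi>' n' m' M' s' where v: "valid_instance \<phi>' n' m' M' s'" and sat: "sat M' s' \<phi>'"
    and eq: "enc_instance \<phi> n m M s = enc_instance \<phi>' n' m' M' s'"
    unfolding KC_imp_model_checking_def by blast
  from eq have 1: "\<phi> = \<phi>'" "n = n'"
    by (auto simp: enc_instance_def enc_fml_append_inject enc_nat_append_inject)
  with eq have 2: "enc_table n n (\<lambda>a b. (a, b) \<in> acc M) = enc_table n n (\<lambda>a b. (a, b) \<in> acc M')"
    and 3: "m = m'"
    by (auto simp: enc_instance_def enc_nat_append_inject length_enc_table)
  with eq 1 have 4: "enc_table m n (\<lambda>p a. a \<in> val M p) = enc_table m n (\<lambda>p a. a \<in> val M' p)"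
    and 5: "enc_nat s = enc_nat s'"
    by (auto simp: enc_instance_def enc_nat_append_inject length_enc_table)
  have s: "s = s'" using 5 enc_nat_append_inject[of s "[]" s' "[]"] by simp
  have sub: "acc M \<subseteq> {..<n} \<times> {..<n}" "acc M' \<subseteq> {..<n} \<times> {..<n}"
    using assms v 1 by (auto simp: valid_instance_def KC_model_def)
  have "acc M = acc M'"
    using 2 sub by (fastforce simp: enc_table_inject)
  moreover have "a \<in> val M p \<longleftrightarrow> a \<in> val M' p" if "p \<in> vars \<phi>" "a \<in> {..<n}" for p a
    using 4 that assms by (auto simp: enc_table_inject valid_instance_def)
  ultimately have "sat M s \<phi> = sat M' s \<phi>"
    using sub assms by (intro sat_cong) (auto simp: valid_instance_def)
  then show "sat M s \<phi>" using sat s 1 by simp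
next
  assume "sat M s \<phi>"
  then show "enc_instance \<phi> n m M s \<in> KC_imp_model_checking"
    using assms unfolding KC_imp_model_checking_def by blast
qed


section \<open>Polynomial time\<close>

datatype symbol = Blank | Bit bool | Aux nat

datatype direction = Left | Stay | Right

text \<open>Tapes are infinite to the right only; moving left from cell 0 has no effect.\<close>

primrec move :: "direction \<Rightarrow> nat \<Rightarrow> nat" where
  "move Left i = i - 1"
| "move Stay i = i"
| "move Right i = Suc i"

record tm =
  tm_states :: "nat set"
  tm_alphabet :: "symbol set"
  tm_start :: nat
  tm_accept :: nat
  tm_reject :: nat
  tm_delta :: "nat \<Rightarrow> symbol \<Rightarrow> nat \<times> symbol \<times> direction"

definition wf_tm :: "tm \<Rightarrow> bool" where
  "wf_tm M \<longleftrightarrow>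
     finite (tm_states M) \<and> finite (tm_alphabet M) \<and>
     {Blank, Bit False, Bit True} \<subseteq> tm_alphabet M \<and>
     {tm_start M, tm_accept M, tm_reject M} \<subseteq> tm_states M \<and> tm_accept M \<noteq> tm_reject M \<and>
     (\<forall>q\<in>tm_states M. \<forall>a\<in>tm_alphabet M.
        tm_delta M q a \<in> tm_states M \<times> tm_alphabet M \<times> UNIV)"

text \<open>A configuration consists of the state, the head position and the tape contents.\<close>

type_synonym tm_config = "nat \<times> nat \<times> (nat \<Rightarrow> symbol)"

definition tm_init :: "tm \<Rightarrow> bool list \<Rightarrow> tm_config" where
  "tm_init M x = (tm_start M, 0, \<lambda>i. if i < length x then Bit (x ! i) else Blank)"

fun tm_step :: "tm \<Rightarrow> tm_config \<Rightarrow> tm_config" where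
  "tm_step M (q, h, tape) =
     (if q = tm_accept M \<or> q = tm_reject M then (q, h, tape)
      else case tm_delta M q (tape h) of
        (q', b, d) \<Rightarrow> (q', move d h, tape(h := b)))"

definition tm_decides_in_time :: "tm \<Rightarrow> language \<Rightarrow> (nat \<Rightarrow> nat) \<Rightarrow> bool" where
  "tm_decides_in_time M A T \<longleftrightarrow>
     (\<forall>x. fst ((tm_step M ^^ T (length x)) (tm_init M x)) =
            (if x \<in> A then tm_accept M else tm_reject M))"

definition class_P :: "language set" where
  "class_P =
     {A. \<exists>M T k. wf_tm M \<and> tm_decides_in_time M A T \<and> (\<lambda>n. real (T n)) \<in> O(\<lambda>n. real n ^ k)}"


section \<open>Logspace many-one reductions\<close>

text \<open>
  A transducer has a two-way read-only input tape delimited by end markers, a fixed number of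
  work tapes, and a write-only output tape to which each step appends at most one symbol.
  Only the work tapes count towards the space.
\<close>

datatype input_symbol = Left_End | Input bool | Right_End

record transducer =
  tr_tapes :: nat
  tr_states :: "nat set"
  tr_alphabet :: "symbol set"
  tr_start :: nat
  tr_halt :: nat
  tr_delta :: "nat \<Rightarrow> input_symbol \<Rightarrow> symbol list \<Rightarrow>
    nat \<times> direction \<times> (symbol \<times> direction) list \<times> bool option"

definition wf_transducer :: "transducer \<Rightarrow> bool" where
  "wf_transducer M \<longleftrightarrow>
     finite (tr_states M) \<and> finite (tr_alphabet M) \<and> Blank \<in> tr_alphabet M \<and>
     {tr_start M, tr_halt M} \<subseteq> tr_states M \<and>
     (\<forall>q\<in>tr_states M. \<forall>i. \<forall>as\<in>lists (tr_alphabet M). length as = tr_tapes M \<longrightarrow>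
        (case tr_delta M q i as of (q', d, ws, out) \<Rightarrow>
           q' \<in> tr_states M \<and> length ws = tr_tapes M \<and> ws \<in> lists (tr_alphabet M \<times> UNIV)))"

text \<open>
  A configuration consists of the state, the position of the input head, the head position and
  contents of each work tape, and the output written so far. On an input \<open>x\<close>, the input head
  stays within the positions \<open>0, \<dots>, length x + 1\<close>, the first and last of which carry the end
  markers.
\<close>

type_synonym tr_config = "nat \<times> nat \<times> (nat \<times> (nat \<Rightarrow> symbol)) list \<times> bool list"

definition read_input :: "bool list \<Rightarrow> nat \<Rightarrow> input_symbol" where
  "read_input x i =
     (if i = 0 then Left_End else if i \<le> length x then Input (x ! (i - 1)) else Right_End)"

definition tr_init :: "transducer \<Rightarrow> tr_config" where
  "tr_init M = (tr_start M, 0, replicate (tr_tapes M) (0, \<lambda>_. Blank), [])"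

fun tr_step :: "transducer \<Rightarrow> bool list \<Rightarrow> tr_config \<Rightarrow> tr_config" where
  "tr_step M x (q, i, works, y) =
     (if q = tr_halt M then (q, i, works, y)
      else case tr_delta M q (read_input x i) (map (\<lambda>(h, tape). tape h) works) of
        (q', d, ws, out) \<Rightarrow>
          (q', min (move d i) (Suc (length x)),
           map2 (\<lambda>(h, tape) (b, e). (move e h, tape(h := b))) works ws,
           y @ (case out of None \<Rightarrow> [] | Some b \<Rightarrow> [b])))"

definition tr_computes :: "transducer \<Rightarrow> (bool list \<Rightarrow> bool list) \<Rightarrow> bool" where
  "tr_computes M f \<longleftrightarrow>
     (\<forall>x. \<exists>t i works. (tr_step M x ^^ t) (tr_init M) = (tr_halt M, i, works, f x))"

definition tr_runs_in_space :: "transducer \<Rightarrow> (nat \<Rightarrow> nat) \<Rightarrow> bool" where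
  "tr_runs_in_space M S \<longleftrightarrow>
     (\<forall>x t q i works y. (tr_step M x ^^ t) (tr_init M) = (q, i, works, y) \<longrightarrow>
        (\<forall>(h, tape)\<in>set works. h < S (length x)))"

definition logspace_computable :: "(bool list \<Rightarrow> bool list) \<Rightarrow> bool" where
  "logspace_computable f \<longleftrightarrow>
     (\<exists>M S. wf_transducer M \<and> tr_computes M f \<and> tr_runs_in_space M S \<and>
        (\<lambda>n. real (S n)) \<in> O(\<lambda>n. ln (real n)))"

definition logspace_reducible :: "language \<Rightarrow> language \<Rightarrow> bool" where
  "logspace_reducible A B \<longleftrightarrow> (\<exists>f. logspace_computable f \<and> (\<forall>x. x \<in> A \<longleftrightarrow> f x \<in> B))"

definition P_hard :: "language \<Rightarrow> bool" where
  "P_hard B \<longleftrightarrow> (\<forall>A\<in>class_P. logspace_reducible A B)"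

end

theory Submission
  imports Defs "HOL-Library.Countable" "HOL-Library.Nat_Bijection" "HOL-Real_Asymp.Real_Asymp"
begin

text \<open>
  Arrange worlds in layers and let \<open>p\<^sub>l\<close> be true exactly strictly above layer \<open>l\<close> (that is, in the
  layers \<open>< l\<close>). With \<open>\<alpha>\<^sub>0 = q\<close> and \<open>\<alpha>\<^sub>l\<^sub>+\<^sub>1 = \<alpha>\<^sub>l \<Rightarrow> p\<^sub>l\<close>, a world of layer \<open>l + 1\<close> satisfies \<open>\<alpha>\<^sub>l\<^sub>+\<^sub>1\<close> iff none of
  its successors in layer \<open>l\<close> satisfies \<open>\<alpha>\<^sub>l\<close>: the model evaluates a layered circuit of NOR gates.
  Worlds at least two layers down are irrelevant, so all of them may be made accessible, which yields
  transitivity for free; a greatest cluster satisfying all variables yields directedness.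

  The computation tableau of a polynomial time machine is such a circuit, with two layers per
  time step: cell \<open>i\<close> has content \<open>\<gamma>\<close> at time \<open>t + 1\<close> iff no window of three cells at time \<open>t\<close> that
  yields a content other than \<open>\<gamma>\<close> is present, and a window is present iff no cell contradicts it.

  The instance is written by nested loops over numbers below a polynomial bound \<open>B\<close>. Such programs
  run on a register machine, whose registers are kept in binary on one work tape: cell \<open>j + 1\<close>
  holds the \<open>j\<close>th bits of all registers, so that increments and comparisons are single
  passes of a finite automaton over the tape.
\<close>

section \<open>A register machine in logarithmic space\<close>

datatype test = Less nat nat | Scan "input_symbol list"

datatype cmd =
    Skip
  | Out bool
  | Move direction
  | Inc nat
  | Clear nat
  | Seq cmd cmd
  | Cond test cmd cmd
  | While test cmd

datatype mode = Init | Go | Up bool | Down bool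

text \<open>The control states will be pairs of a command list and a mode, whereas a
  \<open>transducer\<close> has numbers as states; \<open>to_nat\<close> translates between the
  two.\<close>

instance direction :: countable by countable_datatype
instance input_symbol :: countable by countable_datatype
instance test :: countable by countable_datatype
instance cmd :: countable by countable_datatype
instance mode :: countable by countable_datatype

primrec test_regs :: "test \<Rightarrow> nat set" where
  "test_regs (Less v w) = {v, w}"
| "test_regs (Scan is) = {}"

primrec regs :: "cmd \<Rightarrow> nat set" where
  "regs Skip = {}"
| "regs (Out b) = {}"
| "regs (Move d) = {}"
| "regs (Inc r) = {r}"
| "regs (Clear r) = {r}"
| "regs (Seq c d) = regs c \<union> regs d"
| "regs (Cond t c d) = test_regs t \<union> regs c \<union> regs d"
| "regs (While t c) = test_regs t \<union> regs c"

lemma finite_regs: "finite (regs c)"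
proof -
  have "finite (test_regs t)" for t by (cases t) auto
  then show ?thesis by (induction c) auto
qed

primrec holds :: "bool list \<Rightarrow> (nat \<Rightarrow> nat) \<Rightarrow> nat \<Rightarrow> test \<Rightarrow> bool" where
  "holds x s h (Less v w) \<longleftrightarrow> s v < s w"
| "holds x s h (Scan is) \<longleftrightarrow> read_input x h \<in> set is"

text \<open>The bound \<open>W\<close> on the bit length of the registers is built into the semantics of \<open>Inc\<close>.\<close>

inductive exec :: "bool list \<Rightarrow> nat \<Rightarrow> cmd \<Rightarrow> (nat \<Rightarrow> nat) \<Rightarrow> nat \<Rightarrow> (nat \<Rightarrow> nat) \<Rightarrow> nat \<Rightarrow> bool list \<Rightarrow> bool"
  for x W where
  Skip: "exec x W Skip s h s h []"
| Out: "exec x W (Out b) s h s h [b]"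
| Move: "h' = min (move d h) (Suc (length x)) \<Longrightarrow> exec x W (Move d) s h s h' []"
| Inc: "Suc (s r) < 2 ^ W \<Longrightarrow> s' = s(r := Suc (s r)) \<Longrightarrow> exec x W (Inc r) s h s' h []"
| Clear: "s' = s(r := 0) \<Longrightarrow> exec x W (Clear r) s h s' h []"
| Seq: "exec x W c s h s' h' y \<Longrightarrow> exec x W d s' h' s'' h'' z \<Longrightarrow> exec x W (Seq c d) s h s'' h'' (y @ z)"
| CondT: "holds x s h t \<Longrightarrow> exec x W c s h s' h' y \<Longrightarrow> exec x W (Cond t c d) s h s' h' y"
| CondF: "\<not> holds x s h t \<Longrightarrow> exec x W d s h s' h' y \<Longrightarrow> exec x W (Cond t c d) s h s' h' y"
| WhileF: "\<not> holds x s h t \<Longrightarrow> exec x W (While t c) s h s h []"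
| WhileT: "holds x s h t \<Longrightarrow> exec x W c s h s' h' y \<Longrightarrow> exec x W (While t c) s' h' s'' h'' z \<Longrightarrow>
    exec x W (While t c) s h s'' h'' (y @ z)"

text \<open>The commands that need a pass over the work tape; any other command takes a single step
  of the machine.\<close>

fun scans :: "cmd \<Rightarrow> bool" where
  "scans (Inc r) = True"
| "scans (Clear r) = True"
| "scans (Cond (Less v w) c d) = True"
| "scans (While (Less v w) c) = True"
| "scans _ = False"

text \<open>
  One step of a pass over the columns, least significant bits first. The flag \<open>\<sigma>\<close> is the carry
  of \<open>Inc\<close>, and for \<open>Less v w\<close> the result of the comparison of the bits read so far.
\<close>

fun scan_column :: "cmd \<Rightarrow> bool \<Rightarrow> nat set \<Rightarrow> bool \<times> nat set" where
  "scan_column (Inc r) \<sigma> C = (\<sigma> \<and> r \<in> C, if \<sigma> then (if r \<in> C then C - {r} else insert r C) else C)"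
| "scan_column (Clear r) \<sigma> C = (\<sigma>, C - {r})"
| "scan_column (Cond (Less v w) c d) \<sigma> C = (if (v \<in> C) = (w \<in> C) then \<sigma> else w \<in> C, C)"
| "scan_column (While (Less v w) c) \<sigma> C = (if (v \<in> C) = (w \<in> C) then \<sigma> else w \<in> C, C)"
| "scan_column _ \<sigma> C = (\<sigma>, C)"

fun branch :: "cmd \<Rightarrow> bool \<Rightarrow> cmd list \<Rightarrow> cmd list" where
  "branch (Seq c d) \<sigma> k = c # d # k"
| "branch (Cond t c d) \<sigma> k = (if \<sigma> then c else d) # k"
| "branch (While t c) \<sigma> k = (if \<sigma> then c # While t c # k else k)"
| "branch _ \<sigma> k = k"

fun scan_result :: "cmd \<Rightarrow> input_symbol \<Rightarrow> bool" where
  "scan_result (Cond (Scan is) c d) i = (i \<in> set is)"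
| "scan_result (While (Scan is) c) i = (i \<in> set is)"
| "scan_result _ i = False"

fun head_move :: "cmd \<Rightarrow> direction" where
  "head_move (Move d) = d"
| "head_move _ = Stay"

fun emitted :: "cmd \<Rightarrow> bool option" where
  "emitted (Out b) = Some b"
| "emitted _ = None"

text \<open>A carry that survives the pass needs a new most significant column, in which only
  \<open>r\<close> has a bit. Intersecting with \<open>{..<R}\<close> keeps the symbol in the
  alphabet whatever registers the program mentions.\<close>

fun overflow :: "nat \<Rightarrow> cmd \<Rightarrow> bool \<Rightarrow> symbol" where
  "overflow R (Inc r) \<sigma> = (if \<sigma> then Aux (set_encode ({r} \<inter> {..<R})) else Blank)"
| "overflow R _ \<sigma> = Blank"

fun carry_in :: "cmd \<Rightarrow> bool" where
  "carry_in (Inc r) = True"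
| "carry_in _ = False"

text \<open>
  The control state consists of the commands that remain to be executed and a mode. Cell 0 is marked
  by \<open>Bit True\<close>, since moving left from it would otherwise go unnoticed. A pass runs \<open>Up\<close> to
  the first blank, where \<open>Inc\<close> may append a column, and then \<open>Down\<close> to the marker.
\<close>

fun control :: "nat \<Rightarrow> cmd list \<Rightarrow> mode \<Rightarrow> input_symbol \<Rightarrow> symbol \<Rightarrow>
    (cmd list \<times> mode) \<times> direction \<times> (symbol \<times> direction) \<times> bool option" where
  "control R [] m i a = (([], Go), Stay, (a, Stay), None)"
| "control R (c # k) Init i a = ((c # k, Go), Stay, (Bit True, Stay), None)"
| "control R (c # k) Go i a =
     (if scans c then ((c # k, Up (carry_in c)), Stay, (a, Right), None)
      else ((branch c (scan_result c i) k, Go), head_move c, (a, Stay), emitted c))"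
| "control R (c # k) (Up \<sigma>) i a =
     (case a of
        Aux m \<Rightarrow> (case scan_column c \<sigma> (set_decode m) of
          (\<sigma>', C) \<Rightarrow> ((c # k, Up \<sigma>'), Stay, (Aux (set_encode (C \<inter> {..<R})), Right), None))
      | _ \<Rightarrow> ((c # k, Down \<sigma>), Stay, (overflow R c \<sigma>, Left), None))"
| "control R (c # k) (Down \<sigma>) i a =
     (if a = Bit True then ((branch c \<sigma> k, Go), Stay, (a, Stay), None)
      else ((c # k, Down \<sigma>), Stay, (a, Left), None))"

text \<open>The continuations that can arise while the first command of \<open>c # k\<close> is executed.\<close>

primrec conts :: "cmd \<Rightarrow> cmd list \<Rightarrow> cmd list set" where
  "conts Skip k = {Skip # k}"
| "conts (Out b) k = {Out b # k}"
| "conts (Move d) k = {Move d # k}"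
| "conts (Inc r) k = {Inc r # k}"
| "conts (Clear r) k = {Clear r # k}"
| "conts (Seq c d) k = insert (Seq c d # k) (conts c (d # k) \<union> conts d k)"
| "conts (Cond t c d) k = insert (Cond t c d # k) (conts c k \<union> conts d k)"
| "conts (While t c) k = insert (While t c # k) (conts c (While t c # k))"

lemma finite_conts: "finite (conts c k)"
  by (induction c arbitrary: k) auto

lemma conts_self: "c # k \<in> conts c k"
  by (cases c) auto

text \<open>The reason why finitely many control states suffice: the body of a loop is continued by
  that same loop, so unfolding it repeatedly brings no new continuations.\<close>

lemma conts_branch: "c # k' \<in> conts p k \<Longrightarrow> branch c \<sigma> k' \<in> insert k (conts p k)"
proof (induction p arbitrary: k)
  case (Seq p1 p2)
  then show ?case using conts_self by fastforce
next
  case (Cond t p1 p2)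
  then show ?case using conts_self by (fastforce split: if_splits)
next
  case (While t p)
  then show ?case using conts_self by (fastforce split: if_splits)
qed auto

definition alphabet :: "nat \<Rightarrow> symbol set" where
  "alphabet R = {Blank, Bit True} \<union> (\<lambda>C. Aux (set_encode C)) ` Pow {..<R}"

definition machine :: "cmd \<Rightarrow> nat \<Rightarrow> transducer" where
  "machine p R =
     \<lparr>tr_tapes = 1,
      tr_states = to_nat ` (insert [] (conts p []) \<times> (UNIV :: mode set)),
      tr_alphabet = alphabet R,
      tr_start = to_nat ([p], Init),
      tr_halt = to_nat ([] :: cmd list, Go),
      tr_delta = \<lambda>q i as. case from_nat q of (k, m) \<Rightarrow>
        (case control R k m i (hd as) of (q', d, w, out) \<Rightarrow> (to_nat q', d, [w], out))\<rparr>"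

lemma finite_mode: "finite (UNIV :: mode set)"
proof -
  have "m \<in> {Init, Go, Up True, Up False, Down True, Down False}" for m
    by (cases m) auto
  then have "UNIV = {Init, Go, Up True, Up False, Down True, Down False}" by blast
  then show ?thesis by (metis finite.emptyI finite.insertI)
qed

lemma control_closed:
  assumes "k \<in> insert [] (conts p [])" "a \<in> alphabet R" "control R k m i a = ((k', m'), d, (b, e), out)"
  shows "k' \<in> insert [] (conts p []) \<and> b \<in> alphabet R"
proof (cases k)
  case Nil
  then show ?thesis using assms by auto
next
  case (Cons c ks)
  have 1: "branch c \<sigma> ks \<in> insert [] (conts p [])" for \<sigma>
    using assms(1) Cons conts_branch by auto
  have 2: "overflow R c \<sigma> \<in> alphabet R" for \<sigma>
    by (cases "(R, c, \<sigma>)" rule: overflow.cases) (auto simp: alphabet_def)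
  have 3: "Aux (set_encode (C \<inter> {..<R})) \<in> alphabet R" for C
    by (auto simp: alphabet_def)
  have 4: "Bit True \<in> alphabet R" by (simp add: alphabet_def)
  have k: "c # ks \<in> insert [] (conts p [])" using assms(1) Cons by simp
  show ?thesis
  proof (cases m)
    case Init
    then show ?thesis using assms(3) Cons k 4 by auto
  next
    case Go
    then show ?thesis using assms(2,3) Cons k 1 by (auto split: if_splits)
  next
    case (Up \<sigma>)
    then show ?thesis using assms(3) Cons k 2 3 by (auto split: symbol.splits prod.splits)
  next
    case (Down \<sigma>)
    then show ?thesis using assms(2,3) Cons k 1 by (auto split: if_splits)
  qed
qed

lemma wf_machine: "wf_transducer (machine p R)"
proof -
  let ?M = "machine p R" and ?Q = "insert [] (conts p []) \<times> (UNIV :: mode set)"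
  have "finite ?Q" by (intro finite_cartesian_product finite_mode finite.insertI finite_conts)
  then have "finite (tr_states ?M)"
    by (simp only: machine_def transducer.simps) (rule finite_imageI)
  moreover have "finite (tr_alphabet ?M)" "Blank \<in> tr_alphabet ?M"
    by (simp_all add: machine_def alphabet_def)
  moreover have "([p], Init) \<in> ?Q" "([], Go) \<in> ?Q" using conts_self[of p "[]"] by auto
  then have "to_nat ([p], Init) \<in> to_nat ` ?Q" "to_nat ([] :: cmd list, Go) \<in> to_nat ` ?Q"
    by (blast intro: imageI)+
  then have "{tr_start ?M, tr_halt ?M} \<subseteq> tr_states ?M"
    by (simp only: machine_def transducer.simps) blast
  moreover have delta: "case tr_delta ?M q i as of (q', d, ws, out) \<Rightarrow>
      q' \<in> tr_states ?M \<and> length ws = tr_tapes ?M \<and> ws \<in> lists (tr_alphabet ?M \<times> UNIV)"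
    if q_as: "q \<in> tr_states ?M" "as \<in> lists (tr_alphabet ?M)" "length as = tr_tapes ?M" for q i as
  proof -
    have "q \<in> to_nat ` ?Q" using q_as(1) by (simp add: machine_def)
    then obtain k and m :: mode where q: "q = to_nat (k, m)" and k: "k \<in> insert [] (conts p [])"
      by auto
    obtain a where as: "as = [a]" and a: "a \<in> alphabet R"
      using q_as(2,3) by (cases as) (auto simp: machine_def)
    obtain k' m' d b e out where *: "control R k m i a = ((k', m'), d, (b, e), out)"
      by (cases "control R k m i a") auto
    have closed: "(k', m') \<in> ?Q" "b \<in> alphabet R"
      using control_closed[OF k a *] by blast+
    have "tr_delta ?M q i as = (to_nat (k', m'), d, [(b, e)], out)"
      using * by (simp add: machine_def q as)
    moreover have "to_nat (k', m') \<in> tr_states ?M"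
      unfolding machine_def transducer.simps using closed(1) by (rule imageI)
    moreover have "tr_tapes ?M = 1" "tr_alphabet ?M = alphabet R" by (simp_all add: machine_def)
    ultimately show ?thesis using closed(2) by (simp del: UNIV_Times_UNIV)
  qed
  ultimately show ?thesis
    unfolding wf_transducer_def by (intro conjI ballI allI impI delta) assumption+
qed

section \<open>Simulation of commands by the transducer\<close>

definition fits :: "nat \<Rightarrow> tr_config \<Rightarrow> bool" where
  "fits S C \<longleftrightarrow> (case C of (q, i, works, y) \<Rightarrow> \<forall>(h, tape)\<in>set works. h < S)"

abbreviation cfg :: "cmd list \<Rightarrow> mode \<Rightarrow> nat \<Rightarrow> nat \<Rightarrow> (nat \<Rightarrow> symbol) \<Rightarrow> bool list \<Rightarrow> tr_config" where
  "cfg k m h j tape y \<equiv> (to_nat (k, m), h, [(j, tape)], y)"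

text \<open>A run together with its space bound: every configuration from which a step is taken must
  fit, so composing runs also composes the bounds. The last configuration is not checked.\<close>

definition reach :: "cmd \<Rightarrow> nat \<Rightarrow> bool list \<Rightarrow> nat \<Rightarrow> tr_config \<Rightarrow> tr_config \<Rightarrow> bool" where
  "reach p R x S = (\<lambda>C C'. fits S C \<and> C' = tr_step (machine p R) x C)\<^sup>*\<^sup>*"

lemma reach_refl: "reach p R x S C C"
  by (simp add: reach_def)

lemma reach_trans [trans]: "reach p R x S C C' \<Longrightarrow> reach p R x S C' C'' \<Longrightarrow> reach p R x S C C''"
  by (simp add: reach_def)

lemma machine_step:
  assumes "k \<noteq> []" "control R k m (read_input x h) (tape j) = ((k', m'), d, (b, e), out)"
  shows "tr_step (machine p R) x (cfg k m h j tape y) =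
    cfg k' m' (min (move d h) (Suc (length x))) (move e j) (tape(j := b))
      (y @ (case out of None \<Rightarrow> [] | Some b \<Rightarrow> [b]))"
proof -
  have "to_nat (k, m) \<noteq> to_nat ([] :: cmd list, Go)" using assms(1) by simp
  then show ?thesis using assms(2) by (simp add: machine_def del: to_nat_split)
qed

lemma reach_step:
  assumes "k \<noteq> []" "control R k m (read_input x h) (tape j) = ((k', m'), d, (b, e), out)" "j < S"
    and "h' = min (move d h) (Suc (length x))" "j' = move e j" "tape' = tape(j := b)"
    and "y' = y @ (case out of None \<Rightarrow> [] | Some b \<Rightarrow> [b])"
  shows "reach p R x S (cfg k m h j tape y) (cfg k' m' h' j' tape' y')"
  unfolding reach_def using machine_step[OF assms(1), where R = R and m = m and x = x and h = h and tape = tape and j = j and p = p and y = y, OF assms(2)] assms(3-)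
  by (intro r_into_rtranclp) (simp add: fits_def)

definition column :: "nat \<Rightarrow> (nat \<Rightarrow> nat) \<Rightarrow> nat \<Rightarrow> nat set" where
  "column R s j = {r. r < R \<and> bit (s r) j}"

text \<open>\<open>L\<close> is the current number of columns. It may exceed what the values
  require, because columns are added by \<open>Inc\<close> but never removed.\<close>

definition stores :: "nat \<Rightarrow> nat \<Rightarrow> (nat \<Rightarrow> nat) \<Rightarrow> (nat \<Rightarrow> symbol) \<Rightarrow> bool" where
  "stores R L s tape \<longleftrightarrow>
     tape 0 = Bit True \<and> (\<forall>r<R. s r < 2 ^ L) \<and>
     (\<forall>j. tape (Suc j) = (if j < L then Aux (set_encode (column R s j)) else Blank))"

lemma finite_column [simp]: "finite (column R s j)"
  by (simp add: column_def)

lemma column_bounded: "column R s j \<inter> {..<R} = column R s j"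
  by (auto simp: column_def)

lemma pass_up:
  assumes "L < S" "h \<le> Suc (length x)"
    and "\<And>j. j < L \<Longrightarrow> tape (Suc j) = Aux (set_encode (column R s j))"
    and "\<And>j. j < L \<Longrightarrow> scan_column c (\<sigma> j) (column R s j) = (\<sigma> (Suc j), column R s' j)"
  shows "reach p R x S (cfg (c # k) (Up (\<sigma> 0)) h 1 tape y)
    (cfg (c # k) (Up (\<sigma> L)) h (Suc L)
      (\<lambda>i. if 1 \<le> i \<and> i \<le> L then Aux (set_encode (column R s' (i - 1))) else tape i) y)"
  using assms
proof (induction L)
  case 0
  have "(\<lambda>i. if 1 \<le> i \<and> i \<le> 0 then Aux (set_encode (column R s' (i - 1))) else tape i) = tape" by auto
  then show ?case by (auto simp: reach_refl)
next
  case (Suc L)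
  have "reach p R x S (cfg (c # k) (Up (\<sigma> 0)) h 1 tape y)
    (cfg (c # k) (Up (\<sigma> L)) h (Suc L)
      (\<lambda>i. if 1 \<le> i \<and> i \<le> L then Aux (set_encode (column R s' (i - 1))) else tape i) y)"
    using Suc by simp
  also have "reach p R x S \<dots> (cfg (c # k) (Up (\<sigma> (Suc L))) h (Suc (Suc L))
      (\<lambda>i. if 1 \<le> i \<and> i \<le> Suc L then Aux (set_encode (column R s' (i - 1))) else tape i) y)"
    using Suc.prems
    by (intro reach_step[where d = Stay and e = Right and out = None
          and b = "Aux (set_encode (column R s' L))"])
      (auto simp: set_encode_inverse column_bounded fun_eq_iff)
  finally show ?case .
qed

lemma pass_down:
  assumes "j < S" "h \<le> Suc (length x)" "tape 0 = Bit True" "\<And>i. 0 < i \<Longrightarrow> i \<le> j \<Longrightarrow> tape i \<noteq> Bit True"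
  shows "reach p R x S (cfg (c # k) (Down \<sigma>) h j tape y) (cfg (branch c \<sigma> k) Go h 0 tape y)"
  using assms
proof (induction j)
  case 0
  then show ?case
    by (intro reach_step[where d = Stay and e = Stay and out = None and b = "Bit True"]) auto
next
  case (Suc j)
  have "reach p R x S (cfg (c # k) (Down \<sigma>) h (Suc j) tape y) (cfg (c # k) (Down \<sigma>) h j tape y)"
    using Suc.prems
    by (intro reach_step[where d = Stay and e = Left and out = None and b = "tape (Suc j)"]) auto
  also have "reach p R x S \<dots> (cfg (branch c \<sigma> k) Go h 0 tape y)"
    using Suc by simp
  finally show ?case .
qed

text \<open>Reduces each scanning command to naming the flags \<open>\<sigma> j\<close> with which
  the automaton enters column \<open>j\<close> and checking one column. The last hypothesis covers
  the overflow of \<open>Inc\<close>. The head turns at cell \<open>Suc L\<close>, at most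
  \<open>W + 1\<close>, whence the space \<open>W + 2\<close>.\<close>

lemma pass:
  assumes "scans c" "stores R L s tape" "L \<le> W" "L' \<le> W" "h \<le> Suc (length x)"
    and "\<sigma> 0 = carry_in c"
    and "\<And>j. j < L \<Longrightarrow> scan_column c (\<sigma> j) (column R s j) = (\<sigma> (Suc j), column R s' j)"
    and "\<And>r. r < R \<Longrightarrow> s' r < 2 ^ L'"
    and "L' = L \<and> overflow R c (\<sigma> L) = Blank \<or>
         L' = Suc L \<and> overflow R c (\<sigma> L) = Aux (set_encode (column R s' L))"
  shows "\<exists>tape'. stores R L' s' tape' \<and>
    reach p R x (W + 2) (cfg (c # k) Go h 0 tape y) (cfg (branch c (\<sigma> L) k) Go h 0 tape' y)"
proof -
  define tape1 where
    "tape1 = (\<lambda>i. if 1 \<le> i \<and> i \<le> L then Aux (set_encode (column R s' (i - 1))) else tape i)"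
  define tape2 where "tape2 = tape1(Suc L := overflow R c (\<sigma> L))"
  have st: "tape 0 = Bit True" "\<And>j. j < L \<Longrightarrow> tape (Suc j) = Aux (set_encode (column R s j))"
    "\<And>j. L \<le> j \<Longrightarrow> tape (Suc j) = Blank"
    using assms(2) by (auto simp: stores_def)
  have "reach p R x (W + 2) (cfg (c # k) Go h 0 tape y) (cfg (c # k) (Up (\<sigma> 0)) h 1 tape y)"
    using assms(1,5,6)
    by (intro reach_step[where d = Stay and e = Right and out = None and b = "tape 0"]) auto
  also have "reach p R x (W + 2) \<dots> (cfg (c # k) (Up (\<sigma> L)) h (Suc L) tape1 y)"
    unfolding tape1_def using assms st by (intro pass_up) auto
  also have "reach p R x (W + 2) \<dots> (cfg (c # k) (Down (\<sigma> L)) h L tape2 y)"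
    using assms(3,5) st(3)[of L]
    by (intro reach_step[where d = Stay and e = Left and out = None and b = "overflow R c (\<sigma> L)"])
      (auto simp: tape2_def tape1_def)
  also have "reach p R x (W + 2) \<dots> (cfg (branch c (\<sigma> L) k) Go h 0 tape2 y)"
    using assms(3,5) st(1) by (intro pass_down) (auto simp: tape2_def tape1_def)
  finally have "reach p R x (W + 2) (cfg (c # k) Go h 0 tape y) (cfg (branch c (\<sigma> L) k) Go h 0 tape2 y)" .
  moreover have "stores R L' s' tape2"
    unfolding stores_def using assms(8,9) st by (auto simp: tape2_def tape1_def)
  ultimately show ?thesis by blast
qed

text \<open>Adding 1 flips bit \<open>j\<close> iff the carry gets there, that is, iff all lower
  bits are 1. So the flag of \<open>Inc\<close> before column \<open>j\<close> says that all bits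
  below \<open>j\<close> are set.\<close>

lemma bit_Suc_eq: "bit (Suc n) j \<longleftrightarrow> bit n j \<noteq> (\<forall>i<j. bit n i)"
proof (induction j arbitrary: n)
  case 0
  then show ?case by (simp add: bit_0)
next
  case (Suc j)
  have all: "(\<forall>i<Suc j. bit n i) \<longleftrightarrow> odd n \<and> (\<forall>i<j. bit (n div 2) i)"
    by (simp add: All_less_Suc2 bit_0 bit_Suc)
  show ?case
  proof (cases "odd n")
    case True
    then have "Suc n div 2 = Suc (n div 2)" by presburger
    then show ?thesis using Suc[of "n div 2"] all True by (simp add: bit_Suc)
  next
    case False
    then have "Suc n div 2 = n div 2" by presburger
    then show ?thesis using all False by (simp add: bit_Suc)
  qed
qed

text \<open>The carry leaves the top column exactly if the register was full; \<open>mask L\<close>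
  is the only such value.\<close>

lemma all_bits_iff:
  assumes "n < 2 ^ L"
  shows "(\<forall>i<L. bit n i) \<longleftrightarrow> Suc n = (2 :: nat) ^ L"
proof
  assume *: "\<forall>i<L. bit n i"
  have "take_bit L n = mask L"
    using * by (intro bit_eqI) (auto simp: bit_take_bit_iff bit_mask_iff)
  then have "n = 2 ^ L - 1" using assms by (simp add: take_bit_nat_eq_self mask_eq_exp_minus_1)
  then show "Suc n = 2 ^ L" by simp
next
  assume "Suc n = 2 ^ L"
  then have "n = mask L" by (simp add: mask_eq_exp_minus_1)
  then show "\<forall>i<L. bit n i" by (simp add: bit_mask_iff)
qed

text \<open>Comparison starting from the low end: a more significant bit in which the numbers differ
  overrides the verdict so far, and equal bits keep it.\<close>

lemma take_bit_less_Suc: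
  "take_bit (Suc j) (v :: nat) < take_bit (Suc j) w \<longleftrightarrow>
   (if bit v j = bit w j then take_bit j v < take_bit j w else bit w j)"
proof -
  have "take_bit j v < 2 ^ j" "take_bit j w < 2 ^ j" by simp_all
  then show ?thesis by (auto simp: take_bit_Suc_from_most simp del: take_bit_nat_less_exp)
qed

lemma pass_less:
  assumes "scans c" "stores R L s tape" "L \<le> W" "h \<le> Suc (length x)" "v < R" "w < R"
    and "\<And>\<sigma> C. scan_column c \<sigma> C = (if (v \<in> C) = (w \<in> C) then \<sigma> else w \<in> C, C)"
    and "\<not> carry_in c" "\<And>\<sigma>. overflow R c \<sigma> = Blank"
  shows "\<exists>tape'. stores R L s tape' \<and>
    reach p R x (W + 2) (cfg (c # k) Go h 0 tape y) (cfg (branch c (s v < s w) k) Go h 0 tape' y)"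
proof -
  have lt: "\<And>r. r < R \<Longrightarrow> s r < 2 ^ L" using assms(2) by (auto simp: stores_def)
  have "take_bit L (s v) < take_bit L (s w) \<longleftrightarrow> s v < s w"
    using lt assms(5,6) by (simp add: take_bit_nat_eq_self)
  then show ?thesis
    using pass[where \<sigma> = "\<lambda>j. take_bit j (s v) < take_bit j (s w)" and s' = s and L' = L, OF assms(1,2,3)]
      assms lt by (simp add: take_bit_less_Suc column_def)
qed

lemma test_reach:
  assumes "c = Cond t a b \<or> c = While t a" "test_regs t \<subseteq> {..<R}"
    and "stores R L s tape" "L \<le> W" "h \<le> Suc (length x)"
  shows "\<exists>tape'. stores R L s tape' \<and>
    reach p R x (W + 2) (cfg (c # k) Go h 0 tape y) (cfg (branch c (holds x s h t) k) Go h 0 tape' y)"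
proof (cases t)
  case (Less v w)
  have "v < R" "w < R" using assms(2) Less by auto
  then show ?thesis
    using assms(1) unfolding Less holds.simps
    by (elim disjE; intro pass_less[OF _ assms(3-5)]) simp_all
next
  case (Scan "is")
  have "reach p R x (W + 2) (cfg (c # k) Go h 0 tape y)
      (cfg (branch c (holds x s h t) k) Go h 0 tape y)"
    using assms(1,5) Scan
    by (intro reach_step[where d = Stay and e = Stay and out = None and b = "tape 0"]) auto
  then show ?thesis using assms(3) by blast
qed

text \<open>The continuation \<open>k\<close> is arbitrary so that the induction hypothesis can run
  a subcommand with the remainder of its parent still pending.\<close>

lemma exec_reach:
  assumes "exec x W c s h s' h' y'" "regs c \<subseteq> {..<R}" "stores R L s tape" "L \<le> W" "h \<le> Suc (length x)"
  shows "h' \<le> Suc (length x) \<and> (\<exists>L' tape'. L' \<le> W \<and> stores R L' s' tape' \<and>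
    reach p R x (W + 2) (cfg (c # k) Go h 0 tape y) (cfg k Go h' 0 tape' (y @ y')))"
  using assms
proof (induction arbitrary: L tape k y)
  case (Skip s h)
  have "reach p R x (W + 2) (cfg (Skip # k) Go h 0 tape y) (cfg k Go h 0 tape (y @ []))"
    using Skip by (intro reach_step[where d = Stay and e = Stay and out = None and b = "tape 0"]) auto
  then show ?case using Skip by blast
next
  case (Out b s h)
  have "reach p R x (W + 2) (cfg (Out b # k) Go h 0 tape y) (cfg k Go h 0 tape (y @ [b]))"
    using Out by (intro reach_step[where d = Stay and e = Stay and out = "Some b" and b = "tape 0"]) auto
  then show ?case using Out by blast
next
  case (Move h' d h s)
  have "reach p R x (W + 2) (cfg (Move d # k) Go h 0 tape y) (cfg k Go h' 0 tape (y @ []))"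
    using Move by (intro reach_step[where d = d and e = Stay and out = None and b = "tape 0"]) auto
  then show ?case using Move by auto
next
  case (Inc s r s' h)
  have lt: "\<And>r. r < R \<Longrightarrow> s r < 2 ^ L" using Inc by (auto simp: stores_def)
  \<comment> \<open>A column is added exactly on overflow. Then
    \<open>2 ^ L = Suc (s r) < 2 ^ W\<close> by the guard in the rule for \<open>Inc\<close>, so
    there is still room for it.\<close>
  define L' where "L' = (if Suc (s r) = 2 ^ L then Suc L else L)"
  have r: "r < R" using Inc by simp
  have "L' \<le> W"
    using Inc.hyps(1) Inc.prems(3) by (auto simp: L'_def) 
  have ov: "(\<forall>i<L. bit (s r) i) \<longleftrightarrow> Suc (s r) = 2 ^ L"
    using all_bits_iff lt r by blast
  have "\<exists>tape'. stores R L' s' tape' \<and>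
    reach p R x (W + 2) (cfg (Inc r # k) Go h 0 tape y)
      (cfg (branch (Inc r) (\<forall>i<L. bit (s r) i) k) Go h 0 tape' y)"
  proof (rule pass[where \<sigma> = "\<lambda>j. \<forall>i<j. bit (s r) i"])
    show "scan_column (Inc r) (\<forall>i<j. bit (s r) i) (column R s j) =
        (\<forall>i<Suc j. bit (s r) i, column R s' j)" if "j < L" for j
      using r Inc.hyps by (auto simp: column_def less_Suc_eq bit_Suc_eq)
    show "s' q < 2 ^ L'" if "q < R" for q
      using lt[OF that] lt[OF r] Inc.hyps(2) by (auto simp: L'_def)
    have "column R s' L = {r}" if "Suc (s r) = 2 ^ L"
    proof -
      have "\<not> bit (s q) L" if "q < R" for q
        using lt[OF that] by (metis bit_take_bit_iff less_irrefl take_bit_nat_eq_self)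
      then show ?thesis using r that Inc.hyps(2) by (auto simp: column_def bit_exp_iff)
    qed
    then show "L' = L \<and> overflow R (Inc r) (\<forall>i<L. bit (s r) i) = Blank \<or>
         L' = Suc L \<and> overflow R (Inc r) (\<forall>i<L. bit (s r) i) = Aux (set_encode (column R s' L))"
      using r by (auto simp: L'_def ov)
  qed (use Inc \<open>L' \<le> W\<close> in auto)
  then show ?case using \<open>L' \<le> W\<close> Inc.prems by auto
next
  case (Clear s' s r h)
  have lt: "\<And>r. r < R \<Longrightarrow> s r < 2 ^ L" using Clear by (auto simp: stores_def)
  have "\<exists>tape'. stores R L s' tape' \<and>
    reach p R x (W + 2) (cfg (Clear r # k) Go h 0 tape y)
      (cfg (branch (Clear r) False k) Go h 0 tape' y)"
    by (rule pass[where \<sigma> = "\<lambda>_. False"]) (use Clear lt in \<open>auto simp: column_def\<close>)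
  then show ?case using Clear.prems by auto
next
  case (Seq c s h s' h' y1 d s'' h'' z)
  have 1: "reach p R x (W + 2) (cfg (Seq c d # k) Go h 0 tape y) (cfg (c # d # k) Go h 0 tape y)"
    using Seq.prems by (intro reach_step[where d = Stay and e = Stay and out = None and b = "tape 0"]) auto
  obtain L' tape' where 2: "h' \<le> Suc (length x)" "L' \<le> W" "stores R L' s' tape'"
    "reach p R x (W + 2) (cfg (c # d # k) Go h 0 tape y) (cfg (d # k) Go h' 0 tape' (y @ y1))"
    using Seq.IH(1)[of L tape "d # k" y] Seq.prems by auto
  obtain L'' tape'' where 3: "h'' \<le> Suc (length x)" "L'' \<le> W" "stores R L'' s'' tape''"
    "reach p R x (W + 2) (cfg (d # k) Go h' 0 tape' (y @ y1)) (cfg k Go h'' 0 tape'' ((y @ y1) @ z))"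
    using Seq.IH(2)[of L' tape' k "y @ y1"] Seq.prems 2 by auto
  have "reach p R x (W + 2) (cfg (Seq c d # k) Go h 0 tape y) (cfg k Go h'' 0 tape'' (y @ y1 @ z))"
    using reach_trans[OF 1 reach_trans[OF 2(4) 3(4)]] by simp
  then show ?case using 3 by blast
next
  case (CondT s h t c s' h' y1 d)
  have "test_regs t \<subseteq> {..<R}" using CondT.prems(1) by simp
  from test_reach[OF disjI1[OF refl] this CondT.prems(2-4), where k = k and p = p and y = y and a = c and b = d]
  obtain tape1 where 1: "stores R L s tape1"
    "reach p R x (W + 2) (cfg (Cond t c d # k) Go h 0 tape y) (cfg (c # k) Go h 0 tape1 y)"
    using CondT.hyps(1) by auto
  obtain L' tape' where 2: "h' \<le> Suc (length x)" "L' \<le> W" "stores R L' s' tape'"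
    "reach p R x (W + 2) (cfg (c # k) Go h 0 tape1 y) (cfg k Go h' 0 tape' (y @ y1))"
    using CondT.IH[of L tape1 k y] CondT.prems 1 by auto
  then show ?case using reach_trans[OF 1(2) 2(4)] by blast
next
  case (CondF s h t d s' h' y1 c)
  have "test_regs t \<subseteq> {..<R}" using CondF.prems(1) by simp
  from test_reach[OF disjI1[OF refl] this CondF.prems(2-4), where k = k and p = p and y = y and a = c and b = d]
  obtain tape1 where 1: "stores R L s tape1"
    "reach p R x (W + 2) (cfg (Cond t c d # k) Go h 0 tape y) (cfg (d # k) Go h 0 tape1 y)"
    using CondF.hyps(1) by auto
  obtain L' tape' where 2: "h' \<le> Suc (length x)" "L' \<le> W" "stores R L' s' tape'"
    "reach p R x (W + 2) (cfg (d # k) Go h 0 tape1 y) (cfg k Go h' 0 tape' (y @ y1))"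
    using CondF.IH[of L tape1 k y] CondF.prems 1 by auto
  then show ?case using reach_trans[OF 1(2) 2(4)] by blast
next
  case (WhileF s h t c)
  have "test_regs t \<subseteq> {..<R}" using WhileF.prems(1) by simp
  from test_reach[OF disjI2[OF refl] this WhileF.prems(2-4), where k = k and p = p and y = y and a = c]
  obtain tape1 where "stores R L s tape1"
    "reach p R x (W + 2) (cfg (While t c # k) Go h 0 tape y) (cfg k Go h 0 tape1 y)"
    using WhileF.hyps(1) by auto
  then show ?case using WhileF.prems by auto
next
  case (WhileT s h t c s' h' y1 s'' h'' z)
  have "test_regs t \<subseteq> {..<R}" using WhileT.prems(1) by simp
  from test_reach[OF disjI2[OF refl] this WhileT.prems(2-4), where k = k and p = p and y = y and a = c]
  obtain tape1 where 1: "stores R L s tape1"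
    "reach p R x (W + 2) (cfg (While t c # k) Go h 0 tape y) (cfg (c # While t c # k) Go h 0 tape1 y)"
    using WhileT.hyps(1) by auto
  obtain L' tape' where 2: "h' \<le> Suc (length x)" "L' \<le> W" "stores R L' s' tape'"
    "reach p R x (W + 2) (cfg (c # While t c # k) Go h 0 tape1 y) (cfg (While t c # k) Go h' 0 tape' (y @ y1))"
    using WhileT.IH(1)[of L tape1 "While t c # k" y] WhileT.prems 1 by auto
  obtain L'' tape'' where 3: "h'' \<le> Suc (length x)" "L'' \<le> W" "stores R L'' s'' tape''"
    "reach p R x (W + 2) (cfg (While t c # k) Go h' 0 tape' (y @ y1)) (cfg k Go h'' 0 tape'' ((y @ y1) @ z))"
    using WhileT.IH(2)[of L' tape' k "y @ y1"] WhileT.prems 2 by auto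
  have "reach p R x (W + 2) (cfg (While t c # k) Go h 0 tape y) (cfg k Go h'' 0 tape'' (y @ y1 @ z))"
    using reach_trans[OF 1(2) reach_trans[OF 2(4) 3(4)]] by simp
  then show ?case using 3 by blast
qed

lemma reach_steps:
  assumes "reach p R x S C C'"
  shows "\<exists>t. (tr_step (machine p R) x ^^ t) C = C' \<and> (\<forall>u<t. fits S ((tr_step (machine p R) x ^^ u) C))"
  using assms unfolding reach_def
proof (induction rule: rtranclp_induct)
  case base
  show ?case by (intro exI[of _ 0]) simp
next
  case (step C1 C2)
  then obtain t where "(tr_step (machine p R) x ^^ t) C = C1"
    "\<forall>u<t. fits S ((tr_step (machine p R) x ^^ u) C)" by blast
  with step show ?case by (intro exI[of _ "Suc t"]) (auto simp: less_Suc_eq)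
qed

lemma exec_logspace_computable:
  assumes "\<And>x. \<exists>s h. exec x (W (length x)) p (\<lambda>_. 0) 0 s h (f x)"
    and "(\<lambda>n. real (W n + 2)) \<in> O(\<lambda>n. ln (real n))"
  shows "logspace_computable f"
proof -
  obtain R where R: "regs p \<subseteq> {..<R}"
    using finite_regs[of p] using finite_nat_set_iff_bounded by auto
  let ?M = "machine p R"
  have run: "\<exists>t i works. (tr_step ?M x ^^ t) (tr_init ?M) = (tr_halt ?M, i, works, f x) \<and>
      (\<forall>u. fits (W (length x) + 2) ((tr_step ?M x ^^ u) (tr_init ?M)))" for x
  proof -
    let ?S = "W (length x) + 2" and ?T = "(\<lambda>_. Blank)(0 := Bit True)"
    obtain s h where ex: "exec x (W (length x)) p (\<lambda>_. 0) 0 s h (f x)" using assms(1) by blast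
    have init: "tr_init ?M = cfg [p] Init 0 0 (\<lambda>_. Blank) []"
      by (simp add: tr_init_def machine_def)
    have "reach p R x ?S (tr_init ?M) (cfg [p] Go 0 0 ?T [])"
      unfolding init
      by (intro reach_step[where d = Stay and e = Stay and out = None and b = "Bit True"]) auto
    moreover have "stores R 0 (\<lambda>_. 0) ?T" by (simp add: stores_def)
    then obtain tape' where "reach p R x ?S (cfg [p] Go 0 0 ?T []) (cfg [] Go h 0 tape' ([] @ f x))"
      using exec_reach[OF ex R, of 0 ?T p "[]" "[]"] by auto
    ultimately have "reach p R x ?S (tr_init ?M) (cfg [] Go h 0 tape' (f x))"
      using reach_trans by fastforce
    then obtain t where t: "(tr_step ?M x ^^ t) (tr_init ?M) = cfg [] Go h 0 tape' (f x)"
      "\<forall>u<t. fits ?S ((tr_step ?M x ^^ u) (tr_init ?M))" using reach_steps by blast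
    \<comment> \<open>The halting configuration is a fixed point, so the space bound holds at all
      times and not only before \<open>t\<close>.\<close>
    have "(tr_step ?M x ^^ (u + t)) (tr_init ?M) = cfg [] Go h 0 tape' (f x)" for u
      using t(1) by (induction u) (auto simp: machine_def)
    then have "fits ?S ((tr_step ?M x ^^ u) (tr_init ?M))" for u
      using t(2) by (cases "u < t") (auto simp: fits_def not_less dest!: le_Suc_ex simp: add.commute)
    then show ?thesis using t(1) by (auto simp: machine_def)
  qed
  have "tr_computes ?M f" unfolding tr_computes_def using run by blast
  moreover have "tr_runs_in_space ?M (\<lambda>n. W n + 2)"
    unfolding tr_runs_in_space_def
  proof (intro allI impI)
    fix x t q i works y
    assume "(tr_step ?M x ^^ t) (tr_init ?M) = (q, i, works, y)"
    with run[of x] have "fits (W (length x) + 2) (q, i, works, y)" by metis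
    then show "\<forall>(h, tape)\<in>set works. h < W (length x) + 2" by (simp add: fits_def)
  qed
  ultimately show ?thesis
    unfolding logspace_computable_def using wf_machine assms(2) by blast
qed

section \<open>Loop programs\<close>

datatype trm = Zero | Bound | V nat | VS nat

datatype cond = Lt trm trm | In bool nat | Const bool | Neg cond | Con cond cond

text \<open>All loops share the bound \<open>B\<close>, so no arithmetic on bounds is needed; a
  shorter range is a full loop with a \<open>Choose\<close> inside.\<close>

datatype prog = Nop | Emit bool | Then prog prog | Choose cond prog prog | For nat prog

primrec trm_val :: "nat \<Rightarrow> (nat \<Rightarrow> nat) \<Rightarrow> trm \<Rightarrow> nat" where
  "trm_val B e Zero = 0"
| "trm_val B e Bound = B"
| "trm_val B e (V v) = e v"
| "trm_val B e (VS v) = Suc (e v)"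

primrec cond_val :: "bool list \<Rightarrow> nat \<Rightarrow> (nat \<Rightarrow> nat) \<Rightarrow> cond \<Rightarrow> bool" where
  "cond_val x B e (Lt a b) \<longleftrightarrow> trm_val B e a < trm_val B e b"
| "cond_val x B e (In b v) \<longleftrightarrow> e v < length x \<and> x ! e v = b"
| "cond_val x B e (Const b) \<longleftrightarrow> b"
| "cond_val x B e (Neg c) \<longleftrightarrow> \<not> cond_val x B e c"
| "cond_val x B e (Con c d) \<longleftrightarrow> cond_val x B e c \<and> cond_val x B e d"

primrec emits :: "bool list \<Rightarrow> nat \<Rightarrow> (nat \<Rightarrow> nat) \<Rightarrow> prog \<Rightarrow> bool list" where
  "emits x B e Nop = []"
| "emits x B e (Emit b) = [b]"
| "emits x B e (Then p q) = emits x B e p @ emits x B e q"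
| "emits x B e (Choose c p q) = (if cond_val x B e c then emits x B e p else emits x B e q)"
| "emits x B e (For v p) = concat (map (\<lambda>i. emits x B (e(v := i)) p) [0..<B])"

primrec trm_vars :: "trm \<Rightarrow> nat set" where
  "trm_vars Zero = {}"
| "trm_vars Bound = {}"
| "trm_vars (V v) = {v}"
| "trm_vars (VS v) = {v}"

primrec cond_vars :: "cond \<Rightarrow> nat set" where
  "cond_vars (Lt a b) = trm_vars a \<union> trm_vars b"
| "cond_vars (In b v) = {v}"
| "cond_vars (Const b) = {}"
| "cond_vars (Neg c) = cond_vars c"
| "cond_vars (Con c d) = cond_vars c \<union> cond_vars d"

text \<open>Nested loops must use distinct variables, because a loop clears the registers of its
  variable when it ends. Consecutive loops may share one.\<close>

primrec scoped :: "prog \<Rightarrow> nat set \<Rightarrow> bool" where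
  "scoped Nop U \<longleftrightarrow> True"
| "scoped (Emit b) U \<longleftrightarrow> True"
| "scoped (Then p q) U \<longleftrightarrow> scoped p U \<and> scoped q U"
| "scoped (Choose c p q) U \<longleftrightarrow> cond_vars c \<subseteq> U \<and> scoped p U \<and> scoped q U"
| "scoped (For v p) U \<longleftrightarrow> v \<notin> U \<and> scoped p (insert v U)"

text \<open>
  Register 0 stays 0, register 1 holds the loop bound, register 2 its base, and register 3 is scratch.
  Each loop variable \<open>v\<close> is kept together with its successor, so that \<open>Less\<close> suffices for all tests.
\<close>

primrec reg :: "trm \<Rightarrow> nat" where
  "reg Zero = 0"
| "reg Bound = 1"
| "reg (V v) = 4 + 2 * v"
| "reg (VS v) = 5 + 2 * v"

definition rewind :: cmd where
  "rewind = While (Scan [Input True, Input False, Right_End]) (Move Left)"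

text \<open>Conditions become control flow with two targets; \<open>Con\<close> duplicates
  \<open>q\<close>, which is harmless as the program is fixed. For \<open>In b v\<close>, register 3
  counts the moves from head position 1, where input bit 0 lies, to bit \<open>e v\<close>. Beyond
  the input the head rests on \<open>Right_End\<close> and the test fails, as it should.\<close>

primrec compile_cond :: "cond \<Rightarrow> cmd \<Rightarrow> cmd \<Rightarrow> cmd" where
  "compile_cond (Lt a b) p q = Cond (Less (reg a) (reg b)) p q"
| "compile_cond (In b v) p q =
     Seq (Move Right) (Seq (While (Less 3 (reg (V v))) (Seq (Inc 3) (Move Right)))
       (Seq (Clear 3) (Cond (Scan [Input b]) (Seq rewind p) (Seq rewind q))))"
| "compile_cond (Const b) p q = (if b then p else q)"
| "compile_cond (Neg c) p q = compile_cond c q p"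
| "compile_cond (Con c d) p q = compile_cond c (compile_cond d p q) q"

definition loop :: "nat \<Rightarrow> nat \<Rightarrow> cmd \<Rightarrow> cmd" where
  "loop v r c =
     Seq (Inc (5 + 2 * v)) (Seq (While (Less (4 + 2 * v) r) (Seq c (Seq (Inc (4 + 2 * v)) (Inc (5 + 2 * v)))))
       (Seq (Clear (4 + 2 * v)) (Clear (5 + 2 * v))))"

primrec compile :: "prog \<Rightarrow> cmd" where
  "compile Nop = Skip"
| "compile (Emit b) = Out b"
| "compile (Then p q) = Seq (compile p) (compile q)"
| "compile (Choose c p q) = compile_cond c (compile p) (compile q)"
| "compile (For v p) = loop v 1 (compile p)"

lemma exec_Seq': "exec x W c s h s' h' y \<Longrightarrow> exec x W d s' h' s'' h'' z \<Longrightarrow> w = y @ z \<Longrightarrow>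
    exec x W (Seq c d) s h s'' h'' w"
  using exec.Seq by blast

lemma exec_rewind: "h \<le> Suc (length x) \<Longrightarrow> exec x W rewind s h s 0 []"
proof (induction h)
  case 0
  show ?case unfolding rewind_def by (intro exec.WhileF) (simp add: read_input_def)
next
  case (Suc h)
  have "exec x W (Move Left) s (Suc h) s h []"
    using Suc.prems by (intro exec.Move) simp
  moreover have "exec x W rewind s h s 0 []" using Suc by simp
  moreover have "holds x s (Suc h) (Scan [Input True, Input False, Right_End])"
    by (auto simp: read_input_def)
  ultimately show ?case
    unfolding rewind_def using exec.WhileT[where y = "[]" and z = "[]"] by fastforce
qed

text \<open>\<open>T i\<close> is the state after \<open>i\<close> rounds with both registers of
  \<open>v\<close> masked to 0; the actual state overrides these two. The successor register ends at
  \<open>Suc b\<close>, which therefore has to fit into \<open>W\<close> bits.\<close>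

lemma exec_loop:
  assumes "s (4 + 2 * v) = 0" "s (5 + 2 * v) = 0" "Suc b < 2 ^ W"
    and r: "r \<noteq> 4 + 2 * v" "r \<noteq> 5 + 2 * v"
    and T: "T 0 = s" "\<And>i. i \<le> b \<Longrightarrow> T i (4 + 2 * v) = 0 \<and> T i (5 + 2 * v) = 0 \<and> T i r = b"
    and c: "\<And>i. i < b \<Longrightarrow> exec x W c ((T i)(4 + 2 * v := i, 5 + 2 * v := Suc i)) h
      ((T (Suc i))(4 + 2 * v := i, 5 + 2 * v := Suc i)) h (out i)"
  shows "exec x W (loop v r c) s h (T b) h (concat (map out [0..<b]))"
proof -
  let ?lv = "4 + 2 * v" and ?ls = "5 + 2 * v"
  define S where "S i = (T i)(?lv := i, ?ls := Suc i)" for i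
  have loop: "exec x W (While (Less ?lv r) (Seq c (Seq (Inc ?lv) (Inc ?ls)))) (S j) h (S b) h
      (concat (map out [j..<b]))" if "j \<le> b" for j
    using that
  proof (induction rule: inc_induct)
    case base
    have "\<not> holds x (S b) h (Less ?lv r)" using T(2)[of b] r by (simp add: S_def)
    then show ?case by (simp add: exec.WhileF)
  next
    case (step j)
    have "exec x W (Seq (Inc ?lv) (Inc ?ls)) ((T (Suc j))(?lv := j, ?ls := Suc j)) h (S (Suc j)) h []"
      using step.hyps assms(3)
      by (intro exec_Seq'[OF exec.Inc[OF _ refl] exec.Inc]) (auto simp: S_def fun_eq_iff)
    from exec.Seq[OF c[OF step.hyps(2)] this]
    have "exec x W (Seq c (Seq (Inc ?lv) (Inc ?ls))) (S j) h (S (Suc j)) h (out j)"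
      by (simp only: S_def[of j] append_Nil2)
    moreover have "holds x (S j) h (Less ?lv r)"
      using step.hyps T(2)[of j] r by (simp add: S_def)
    ultimately have "exec x W (While (Less ?lv r) (Seq c (Seq (Inc ?lv) (Inc ?ls)))) (S j) h (S b) h
        (out j @ concat (map out [Suc j..<b]))"
      using step.IH exec.WhileT by blast
    then show ?case using step.hyps(2) by (simp add: upt_conv_Cons)
  qed
  have 1: "exec x W (Inc ?ls) s h (S 0) h []"
    using assms(1-3) T(1) by (intro exec.Inc) (auto simp: S_def fun_eq_iff)
  have 2: "exec x W (Seq (Clear ?lv) (Clear ?ls)) (S b) h (T b) h []"
    using T(2)[of b]
    by (intro exec_Seq'[OF exec.Clear[OF refl] exec.Clear])
      (auto simp: S_def fun_eq_iff)
  show ?thesis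
    unfolding loop_def using exec.Seq[OF 1 exec.Seq[OF loop[of 0] 2]] by simp
qed

text \<open>
  The registers of variables that are not in scope are 0, and compiled programs restore all registers.
\<close>

definition represents :: "nat set \<Rightarrow> nat \<Rightarrow> (nat \<Rightarrow> nat) \<Rightarrow> (nat \<Rightarrow> nat) \<Rightarrow> bool" where
  "represents U B e s \<longleftrightarrow> s 0 = 0 \<and> s 1 = B \<and> s 3 = 0 \<and>
     (\<forall>v\<in>U. s (4 + 2 * v) = e v \<and> s (5 + 2 * v) = Suc (e v) \<and> e v < B) \<and>
     (\<forall>v. v \<notin> U \<longrightarrow> s (4 + 2 * v) = 0 \<and> s (5 + 2 * v) = 0)"

lemma represents_trm: "represents U B e s \<Longrightarrow> trm_vars a \<subseteq> U \<Longrightarrow> s (reg a) = trm_val B e a"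
  by (cases a) (auto simp: represents_def)

lemma exec_compile_cond:
  assumes "represents U B e s" "cond_vars c \<subseteq> U" "Suc B < 2 ^ W"
    and "exec x W (if cond_val x B e c then p else q) s 0 s' 0 y"
  shows "exec x W (compile_cond c p q) s 0 s' 0 y"
  using assms
proof (induction c arbitrary: p q)
  case (Lt a b)
  then have "s (reg a) = trm_val B e a" "s (reg b) = trm_val B e b"
    using represents_trm by auto
  then show ?case using Lt(4) by (auto intro: exec.CondT exec.CondF split: if_splits)
next
  case (In b v)
  have v: "s (4 + 2 * v) = e v" "e v < B" and s3: "s 3 = 0"
    using In by (auto simp: represents_def)
  \<comment> \<open>The head position after \<open>j\<close> rounds, held back at the right end
    marker.\<close>
  let ?h = "\<lambda>j. min (Suc j) (Suc (length x))"
  have loop: "exec x W (While (Less 3 (reg (V v))) (Seq (Inc 3) (Move Right)))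
      (s(3 := j)) (?h j) (s(3 := e v)) (?h (e v)) []" if "j \<le> e v" for j
    using that
  proof (induction rule: inc_induct)
    case base
    show ?case using v by (intro exec.WhileF) simp
  next
    case (step j)
    have body: "exec x W (Seq (Inc 3) (Move Right)) (s(3 := j)) (?h j) (s(3 := Suc j)) (?h (Suc j)) []"
      by (rule exec_Seq'[OF exec.Inc exec.Move]) (use step.hyps v In.prems(3) in auto)
    have "holds x (s(3 := j)) (?h j) (Less 3 (reg (V v)))"
      using step.hyps v by simp
    from exec.WhileT[OF this body step.IH] show ?case by (simp only: append_Nil)
  qed
  have "s(3 := 0) = s" using s3 by auto
  then have 1: "exec x W (Move Right) s 0 (s(3 := 0)) (?h 0) []"
    by (simp add: exec.Move)
  have 2: "exec x W (Clear 3) (s(3 := e v)) (?h (e v)) s (?h (e v)) []"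
    using s3 by (intro exec.Clear) auto
  have "read_input x (?h (e v)) = Input b \<longleftrightarrow> cond_val x B e (In b v)"
    by (auto simp: read_input_def min_def)
  then have scan: "holds x s (?h (e v)) (Scan [Input b]) \<longleftrightarrow> cond_val x B e (In b v)"
    by simp
  have rewind: "exec x W rewind s (?h (e v)) s 0 []"
    by (rule exec_rewind) simp
  have 3: "exec x W (Cond (Scan [Input b]) (Seq rewind p) (Seq rewind q)) s (?h (e v)) s' 0 y"
  proof (cases "cond_val x B e (In b v)")
    case True
    then have "exec x W p s 0 s' 0 y" using In.prems(4) by (simp only: if_True)
    from exec.Seq[OF rewind this] show ?thesis
      using scan True by (intro exec.CondT) (simp_all only: append_Nil simp_thms)
  next
    case False
    then have "exec x W q s 0 s' 0 y" using In.prems(4) by (simp only: if_False)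
    from exec.Seq[OF rewind this] show ?thesis
      using scan False by (intro exec.CondF) (simp_all only: append_Nil simp_thms)
  qed
  show ?case
    using exec.Seq[OF 1 exec.Seq[OF loop[of 0] exec.Seq[OF 2 3]]] by simp
next
  case (Const b)
  then show ?case by (cases b) simp_all
next
  case (Neg c)
  have "exec x W (if cond_val x B e c then q else p) s 0 s' 0 y"
    using Neg.prems(4) by (cases "cond_val x B e c") simp_all
  then show ?case using Neg.IH[of q p] Neg.prems(1-3) by simp
next
  case (Con c d)
  have "exec x W (if cond_val x B e c then compile_cond d p q else q) s 0 s' 0 y"
  proof (cases "cond_val x B e c")
    case True
    then have "exec x W (if cond_val x B e d then p else q) s 0 s' 0 y"
      using Con.prems(4) by (cases "cond_val x B e d") simp_all
    then show ?thesis using Con.IH(2)[of p q] Con.prems(1-3) True by simp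
  next
    case False
    then show ?thesis using Con.prems(4) by simp
  qed
  then show ?case using Con.IH(1)[of "compile_cond d p q" q] Con.prems(1-3) by simp
qed

lemma exec_compile:
  assumes "scoped p U" "represents U B e s" "Suc B < 2 ^ W"
  shows "exec x W (compile p) s 0 s 0 (emits x B e p)"
  using assms
proof (induction p arbitrary: U e s)
  case Nop
  show ?case by (simp add: exec.Skip)
next
  case (Emit b)
  show ?case by (simp add: exec.Out)
next
  case (Then p q)
  have "exec x W (compile p) s 0 s 0 (emits x B e p)" "exec x W (compile q) s 0 s 0 (emits x B e q)"
    using Then by auto
  then show ?case by (simp add: exec.Seq)
next
  case (Choose c p q)
  have "exec x W (compile p) s 0 s 0 (emits x B e p)" "exec x W (compile q) s 0 s 0 (emits x B e q)"
    using Choose by auto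
  then show ?case
    using Choose.prems unfolding compile.simps emits.simps
    by (intro exec_compile_cond[where U = U and e = e and B = B]) auto
next
  case (For v p)
  have rep: "represents (insert v U) B (e(v := i)) (s(4 + 2 * v := i, 5 + 2 * v := Suc i))" if "i < B" for i
    using For.prems(1,2) that unfolding represents_def by (auto; presburger)
  show ?case
    unfolding compile.simps emits.simps
  proof (rule exec_loop[where T = "\<lambda>_. s"])
    show "exec x W (compile p) (s(4 + 2 * v := i, 5 + 2 * v := Suc i)) 0
      (s(4 + 2 * v := i, 5 + 2 * v := Suc i)) 0 (emits x B (e(v := i)) p)" if "i < B" for i
      by (rule For.IH[OF _ rep[OF that]]) (use For.prems in auto)
  qed (use For.prems in \<open>auto simp: represents_def\<close>)
qed

section \<open>Computing the polynomial loop bound\<close>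

primrec power_cmd :: "nat \<Rightarrow> cmd" where
  "power_cmd 0 = Inc 1"
| "power_cmd (Suc k) = loop k 2 (power_cmd k)"

text \<open>Nested loops around a single increment. Register 1 may start with any value, since each
  round of the outermost loop continues from the sum of the earlier rounds.\<close>

lemma exec_power:
  assumes "s 2 = n" "\<And>v. v < k \<Longrightarrow> s (4 + 2 * v) = 0 \<and> s (5 + 2 * v) = 0"
    and "s 1 + n ^ k < 2 ^ W" "Suc n < 2 ^ W"
  shows "exec x W (power_cmd k) s h (s(1 := s 1 + n ^ k)) h []"
  using assms
proof (induction k arbitrary: s)
  case 0
  then show ?case by (auto intro!: exec.Inc)
next
  case (Suc k)
  have "exec x W (loop k 2 (power_cmd k)) s h (s(1 := s 1 + n * n ^ k)) h (concat (map (\<lambda>_. []) [0..<n]))"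
  proof (rule exec_loop[where T = "\<lambda>i. s(1 := s 1 + i * n ^ k)"])
    fix i assume "i < n"
    then have "Suc i * n ^ k \<le> n * n ^ k" by (intro mult_right_mono) auto
    then have le: "s 1 + i * n ^ k + n ^ k < 2 ^ W" using Suc.prems(3) by simp
    define S where "S = s(1 := s 1 + i * n ^ k, 4 + 2 * k := i, 5 + 2 * k := Suc i)"
    have "exec x W (power_cmd k) S h (S(1 := S 1 + n ^ k)) h []"
      using Suc.prems le by (intro Suc.IH) (auto simp: S_def)
    moreover have "S(1 := S 1 + n ^ k) = s(1 := s 1 + Suc i * n ^ k, 4 + 2 * k := i, 5 + 2 * k := Suc i)"
      by (auto simp: S_def fun_eq_iff)
    ultimately show "exec x W (power_cmd k) (s(1 := s 1 + i * n ^ k, 4 + 2 * k := i, 5 + 2 * k := Suc i)) h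
      (s(1 := s 1 + Suc i * n ^ k, 4 + 2 * k := i, 5 + 2 * k := Suc i)) h []"
      by (simp only: S_def)
  qed (use Suc.prems in auto)
  moreover have "concat (map (\<lambda>_. []) [0..<n]) = ([] :: bool list)" by simp
  ultimately show ?case by (simp only: power_cmd.simps power_Suc)
qed

primrec add_cmd :: "nat \<Rightarrow> cmd" where
  "add_cmd 0 = Skip"
| "add_cmd (Suc c) = Seq (Inc 2) (add_cmd c)"

lemma exec_add: "s 2 + c < 2 ^ W \<Longrightarrow> exec x W (add_cmd c) s h (s(2 := s 2 + c)) h []"
proof (induction c arbitrary: s)
  case 0
  then show ?case by (simp add: exec.Skip)
next
  case (Suc c)
  then show ?case
    using exec_Seq'[OF exec.Inc[OF _ refl, of s 2] Suc.IH[of "s(2 := Suc (s 2))"] refl]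
    by (simp del: fun_upd_apply add: fun_upd_same)
qed

definition count_cmd :: cmd where
  "count_cmd = Seq (Move Right) (Seq (While (Scan [Input True, Input False]) (Seq (Inc 2) (Move Right))) rewind)"

lemma exec_count:
  assumes "s 2 = 0" "length x < 2 ^ W"
  shows "exec x W count_cmd s 0 (s(2 := length x)) 0 []"
proof -
  have loop: "exec x W (While (Scan [Input True, Input False]) (Seq (Inc 2) (Move Right)))
      (s(2 := j)) (Suc j) (s(2 := length x)) (Suc (length x)) []" if "j \<le> length x" for j
    using that
  proof (induction rule: inc_induct)
    case base
    show ?case by (intro exec.WhileF) (simp add: read_input_def)
  next
    case (step j)
    have body: "exec x W (Seq (Inc 2) (Move Right)) (s(2 := j)) (Suc j) (s(2 := Suc j)) (Suc (Suc j)) []"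
      by (rule exec_Seq'[OF exec.Inc exec.Move]) (use step.hyps assms in auto)
    have "holds x (s(2 := j)) (Suc j) (Scan [Input True, Input False])"
      using step.hyps by (simp add: read_input_def)
    from exec.WhileT[OF this body step.IH] show ?case by (simp only: append_Nil)
  qed
  have "s(2 := 0) = s" using assms(1) by auto
  then have 1: "exec x W (Move Right) s 0 (s(2 := 0)) (Suc 0) []"
    by (simp add: exec.Move)
  show ?thesis
    unfolding count_cmd_def
    using exec.Seq[OF 1 exec.Seq[OF loop[of 0] exec_rewind]] by simp
qed

lemma emits_logspace_computable:
  assumes "scoped p {}" "k > 0"
  shows "logspace_computable (\<lambda>x. emits x ((length x + c) ^ k) (\<lambda>_. 0) p)"
proof (rule exec_logspace_computable)
  define w where "w n = nat \<lceil>log 2 (real (n + c + 2))\<rceil>" for n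
  define W where "W n = w n * k" for n
  have w: "n + c + 2 \<le> 2 ^ w n" for n
  proof -
    have "log 2 (real (n + c + 2)) \<le> real (w n)" by (simp add: w_def)
    then have "real (n + c + 2) \<le> 2 powr real (w n)" by (simp add: log_le_iff)
    then show ?thesis by (simp add: powr_realpow flip: of_nat_le_iff[where ?'a = real])
  qed
  show "\<exists>s h. exec x (W (length x))
      (Seq count_cmd (Seq (add_cmd c) (Seq (power_cmd k) (compile p)))) (\<lambda>_. 0) 0 s h
      (emits x ((length x + c) ^ k) (\<lambda>_. 0) p)" for x
  proof -
    let ?n = "length x" and ?W = "W (length x)"
    let ?N = "?n + c" let ?B = "?N ^ k"
    \<comment> \<open>The width \<open>w\<close> is computed from \<open>?N + 2\<close> rather than
      \<open>?N\<close> for this reason: the \<open>k\<close>th power then leaves room for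
      \<open>Suc ?B\<close>, the final value of a successor register, strictly below
      \<open>2 ^ ?W\<close>.\<close>
    have "?N ^ k + 2 \<le> (?N + 2) ^ k"
    proof -
      obtain j where k: "k = Suc j" using \<open>k > 0\<close> gr0_implies_Suc by blast
      have "?N * ?N ^ j \<le> ?N * (?N + 2) ^ j" by (intro mult_left_mono power_mono) auto
      moreover have "1 \<le> (?N + 2) ^ j" by simp
      ultimately show ?thesis unfolding k power_Suc add_mult_distrib by linarith
    qed
    moreover have "(?N + 2) ^ k \<le> 2 ^ ?W"
      using power_mono[OF w[of ?n], of k] by (simp add: W_def power_mult)
    ultimately have B: "Suc ?B < 2 ^ ?W" by linarith
    have "?N + 2 \<le> (?N + 2) ^ k" using \<open>k > 0\<close> by (intro self_le_power) auto
    with \<open>(?N + 2) ^ k \<le> 2 ^ ?W\<close> have N: "Suc ?N < 2 ^ ?W" by linarith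
    have 1: "exec x ?W count_cmd (\<lambda>_. 0) 0 ((\<lambda>_. 0)(2 := ?n)) 0 []"
      using N by (intro exec_count) auto
    have 2: "exec x ?W (add_cmd c) ((\<lambda>_. 0)(2 := ?n)) 0 ((\<lambda>_. 0)(2 := ?N)) 0 []"
      using exec_add[of "(\<lambda>_. 0)(2 := ?n)" c ?W x 0] N by simp
    have 3: "exec x ?W (power_cmd k) ((\<lambda>_. 0)(2 := ?N)) 0 ((\<lambda>_. 0)(2 := ?N, 1 := ?B)) 0 []"
      using exec_power[of "(\<lambda>_. 0)(2 := ?N)" ?N k ?W x 0] B N by simp
    have 4: "exec x ?W (compile p) ((\<lambda>_. 0)(2 := ?N, 1 := ?B)) 0 ((\<lambda>_. 0)(2 := ?N, 1 := ?B)) 0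
        (emits x ?B (\<lambda>_. 0) p)"
      using assms(1) B by (intro exec_compile[where U = "{}"]) (auto simp: represents_def)
    show ?thesis using exec.Seq[OF 1 exec.Seq[OF 2 exec.Seq[OF 3 4]]] by auto
  qed
  have "(\<lambda>n. log 2 (real (n + c + 2)) + 1) \<in> O(\<lambda>n. ln (real n))"
    by real_asymp
  moreover have "(\<lambda>n. real (w n)) \<in> O(\<lambda>n. log 2 (real (n + c + 2)) + 1)"
  proof (intro bigoI[of _ 1] always_eventually allI)
    fix n
    have "0 \<le> log 2 (real (n + c + 2))" by simp
    then have "real (w n) \<le> log 2 (real (n + c + 2)) + 1"
      unfolding w_def by linarith
    then show "norm (real (w n)) \<le> 1 * norm (log 2 (real (n + c + 2)) + 1)" by simp
  qed
  ultimately have "(\<lambda>n. real (w n)) \<in> O(\<lambda>n. ln (real n))"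
    using landau_o.big_trans by blast
  then have "(\<lambda>n. real k * real (w n)) \<in> O(\<lambda>n. ln (real n))" by simp
  moreover have "(\<lambda>n. 2) \<in> O(\<lambda>n. ln (real n))" by real_asymp
  ultimately have "(\<lambda>n. real k * real (w n) + 2) \<in> O(\<lambda>n. ln (real n))"
    by (rule sum_in_bigo)
  then show "(\<lambda>n. real (W n + 2)) \<in> O(\<lambda>n. ln (real n))"
    by (simp add: W_def mult.commute add.commute)
qed

section \<open>Layered NOR circuits as models\<close>

definition net_acc :: "('w \<Rightarrow> bool) \<Rightarrow> ('w \<Rightarrow> nat) \<Rightarrow> ('w \<Rightarrow> 'w \<Rightarrow> bool) \<Rightarrow> 'w \<Rightarrow> 'w \<Rightarrow> bool" where
  "net_acc apex lay E a b \<longleftrightarrow>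
     apex b \<or> \<not> apex a \<and> (a = b \<or> lay b + 2 \<le> lay a \<or> lay a = Suc (lay b) \<and> E a b)"

text \<open>Variable 0 is \<open>q\<close>, and variable \<open>Suc l\<close> is
  \<open>p\<^sub>l\<close>: indices are shifted by one.\<close>

definition net_val :: "('w \<Rightarrow> bool) \<Rightarrow> ('w \<Rightarrow> nat) \<Rightarrow> ('w \<Rightarrow> bool) \<Rightarrow> nat \<Rightarrow> 'w \<Rightarrow> bool" where
  "net_val apex lay Q p a \<longleftrightarrow> apex a \<or> (case p of 0 \<Rightarrow> lay a = 0 \<and> Q a | Suc l \<Rightarrow> lay a < l)"

text \<open>\<open>w\<close> names the node of each world number. It need not be injective: worlds
  with the same node are accessible from each other.\<close>

definition net_model :: "nat \<Rightarrow> (nat \<Rightarrow> 'w) \<Rightarrow> ('w \<Rightarrow> bool) \<Rightarrow> ('w \<Rightarrow> nat) \<Rightarrow> ('w \<Rightarrow> 'w \<Rightarrow> bool) \<Rightarrow>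
    ('w \<Rightarrow> bool) \<Rightarrow> nat model" where
  "net_model n w apex lay E Q =
     \<lparr>worlds = {..<n},
      acc = {(a, b). a < n \<and> b < n \<and> net_acc apex lay E (w a) (w b)},
      val = \<lambda>p. {a. a < n \<and> net_val apex lay Q p (w a)}\<rparr>"

primrec layer_fml :: "nat \<Rightarrow> fml" where
  "layer_fml 0 = Var 0"
| "layer_fml (Suc l) = Imp (layer_fml l) (Var (Suc l))"

lemma implicational_layer_fml: "implicational (layer_fml l)"
  by (induction l) auto

lemma vars_layer_fml: "vars (layer_fml l) = {..l}"
  by (induction l) (auto simp: atMost_Suc)

text \<open>For transitivity, two proper steps between worlds outside the apex descend at least two
  layers, and all such pairs are accessible. For directedness, \<open>c\<close> is accessible from
  everywhere.\<close>

lemma KC_net_model: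
  assumes "c < n" "apex (w c)"
  shows "KC_model (net_model n w apex lay E Q)"
proof -
  have tr: "net_acc apex lay E a d" if "net_acc apex lay E a b" "net_acc apex lay E b d" for a b d
    using that unfolding net_acc_def by auto
  have mono: "net_val apex lay Q p b" if "net_val apex lay Q p a" "net_acc apex lay E a b" for p a b
    using that unfolding net_acc_def net_val_def by (auto split: nat.splits)
  have "net_acc apex lay E a a" for a by (auto simp: net_acc_def)
  then have "refl_on {..<n} (acc (net_model n w apex lay E Q))"
    by (auto simp: net_model_def refl_on_def)
  moreover have "trans (acc (net_model n w apex lay E Q))"
    by (intro transI) (auto simp: net_model_def dest: tr)
  moreover have "\<forall>a\<in>{..<n}. (a, c) \<in> acc (net_model n w apex lay E Q)"
    using assms by (auto simp: net_model_def net_acc_def)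
  ultimately show ?thesis
    unfolding KC_model_def using assms(1) mono by (auto simp: net_model_def)
qed

lemma sat_mono:
  assumes "KC_model M" "sat M a \<phi>" "(a, b) \<in> acc M"
  shows "sat M b \<phi>"
  using assms(2,3)
proof (induction \<phi> arbitrary: a b)
  case (Var p)
  then show ?case using assms(1) unfolding KC_model_def by auto
next
  case (Imp \<phi> \<psi>)
  have "trans (acc M)" using assms(1) unfolding KC_model_def by simp
  then show ?case using Imp.prems by (auto dest: transD)
qed auto

text \<open>\<open>Vl\<close> is the intended value of each gate. Apex worlds and worlds at least
  two layers below \<open>a\<close> satisfy \<open>Var (Suc l)\<close>, so only the inputs of
  \<open>a\<close> in layer \<open>l\<close>, or \<open>a\<close> and its copies, could refute the
  implication.\<close>

lemma sat_layer_fml: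
  assumes apex: "c < n" "apex (w c)"
    and base: "\<And>a. a < n \<Longrightarrow> \<not> apex (w a) \<Longrightarrow> lay (w a) = 0 \<Longrightarrow> Vl (w a) \<longleftrightarrow> Q (w a)"
    and nor: "\<And>a l. a < n \<Longrightarrow> \<not> apex (w a) \<Longrightarrow> lay (w a) = Suc l \<Longrightarrow>
      Vl (w a) \<longleftrightarrow> (\<forall>b<n. \<not> apex (w b) \<longrightarrow> lay (w b) = l \<longrightarrow> E (w a) (w b) \<longrightarrow> \<not> Vl (w b))"
    and succ: "\<And>a l. a < n \<Longrightarrow> \<not> apex (w a) \<Longrightarrow> lay (w a) = Suc l \<Longrightarrow>
      \<exists>b<n. \<not> apex (w b) \<and> lay (w b) = l \<and> E (w a) (w b)"
    and a: "a < n" "\<not> apex (w a)" "lay (w a) = l"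
  shows "sat (net_model n w apex lay E Q) a (layer_fml l) \<longleftrightarrow> Vl (w a)"
  using a
proof (induction l arbitrary: a)
  case 0
  then show ?case using base[of a] by (auto simp: net_model_def net_val_def)
next
  case (Suc l)
  let ?M = "net_model n w apex lay E Q"
  have mem: "(a, b) \<in> acc ?M \<longleftrightarrow> b < n \<and> net_acc apex lay E (w a) (w b)" for b
    using Suc.prems by (simp add: net_model_def)
  have val: "b \<in> val ?M (Suc l) \<longleftrightarrow> b < n \<and> (apex (w b) \<or> lay (w b) < l)" for b
    by (auto simp: net_model_def net_val_def)
  obtain d where d: "d < n" "\<not> apex (w d)" "lay (w d) = l" "E (w a) (w d)"
    using succ[OF Suc.prems] by blast
  have KC: "KC_model ?M" using apex by (rule KC_net_model)
  show ?case
  proof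
    assume sat: "sat ?M a (layer_fml (Suc l))"
    have "\<not> Vl (w b)" if "b < n" "\<not> apex (w b)" "lay (w b) = l" "E (w a) (w b)" for b
    proof
      assume "Vl (w b)"
      then have "sat ?M b (layer_fml l)" using Suc.IH that by blast
      moreover have "(a, b) \<in> acc ?M" using that Suc.prems by (simp add: mem net_acc_def)
      ultimately have "b \<in> val ?M (Suc l)" using sat by simp
      then show False using that val by simp
    qed
    then show "Vl (w a)" using nor[OF Suc.prems] by blast
  next
    assume "Vl (w a)"
    then have nV: "\<not> sat ?M b (layer_fml l)"
      if "b < n" "\<not> apex (w b)" "lay (w b) = l" "E (w a) (w b)" for b
      using that nor[OF Suc.prems] Suc.IH by blast
    have "b \<in> val ?M (Suc l)" if b: "(a, b) \<in> acc ?M" "sat ?M b (layer_fml l)" for b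
    proof (rule ccontr)
      assume "b \<notin> val ?M (Suc l)"
      with b mem val have *: "b < n" "\<not> apex (w b)" "l \<le> lay (w b)" "net_acc apex lay E (w a) (w b)" by auto
      \<comment> \<open>The world \<open>a\<close> and its copies do not satisfy
        \<open>Var (Suc l)\<close> either, so they must not satisfy \<open>layer_fml l\<close>. By
        monotonicity they do not, as their successor \<open>d\<close> does not; this is the purpose
        of \<open>succ\<close>.\<close>
      have "(b, d) \<in> acc ?M" if "w b = w a"
        using that * d Suc.prems by (simp add: net_model_def net_acc_def)
      then have "w b \<noteq> w a" using sat_mono[OF KC b(2)] nV[OF d] by blast
      then have "lay (w b) = l" "E (w a) (w b)" using * Suc.prems by (auto simp: net_acc_def)
      then show False using nV[OF *(1,2)] b(2) by blast
    qed
    then show "sat ?M a (layer_fml (Suc l))" by simp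
  qed
qed

text \<open>The first component is the state of the machine if its head is on the cell.\<close>

type_synonym cell = "nat option \<times> symbol"

section \<open>Local description of a computation step\<close>

definition action :: "tm \<Rightarrow> nat \<Rightarrow> symbol \<Rightarrow> nat \<times> symbol \<times> direction" where
  "action M q a = (if q = tm_accept M \<or> q = tm_reject M then (q, a, Stay) else tm_delta M q a)"

lemma tm_step_action:
  "tm_step M (q, h, tape) = (case action M q (tape h) of (q', b, d) \<Rightarrow> (q', move d h, tape(h := b)))"
  by (simp add: action_def)

definition config :: "tm \<Rightarrow> bool list \<Rightarrow> nat \<Rightarrow> tm_config" where
  "config M x t = (tm_step M ^^ t) (tm_init M x)"

definition cell_of :: "tm_config \<Rightarrow> nat \<Rightarrow> cell" where
  "cell_of C i = (case C of (q, h, tape) \<Rightarrow> (if i = h then Some q else None, tape i))"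

fun leaving :: "tm \<Rightarrow> direction \<Rightarrow> cell \<Rightarrow> nat option" where
  "leaving M d (None, a) = None"
| "leaving M d (Some q, a) = (case action M q a of (q', b, d') \<Rightarrow> if d' = d then Some q' else None)"

fun written :: "tm \<Rightarrow> cell \<Rightarrow> symbol" where
  "written M (None, a) = a"
| "written M (Some q, a) = fst (snd (action M q a))"

definition choice :: "'a option \<Rightarrow> 'a option \<Rightarrow> 'a option" where
  "choice u v = (case u of None \<Rightarrow> v | Some _ \<Rightarrow> u)"

text \<open>
  A missing neighbour is \<open>None\<close>. Without a left neighbour the cell is cell 0, where a head moving
  left stays.
\<close>

definition next_cell :: "tm \<Rightarrow> cell option \<Rightarrow> cell \<Rightarrow> cell option \<Rightarrow> cell" where
  "next_cell M l c r =
     (choice (Option.bind l (leaving M Right)) (choice (Option.bind r (leaving M Left))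
        (choice (leaving M Stay c) (if l = None then leaving M Left c else None))),
      written M c)"

definition neighbour :: "bool \<Rightarrow> nat \<Rightarrow> (nat \<Rightarrow> cell) \<Rightarrow> cell option" where
  "neighbour ex j f = (if ex then Some (f j) else None)"

lemma neighbour_SomeD: "neighbour ex j f = Some g \<Longrightarrow> g = f j"
  by (simp add: neighbour_def split: if_splits)

text \<open>The tableau is cut off after \<open>B\<close> cells, so its last cell has no right
  neighbour. The hypothesis ensures that no head can enter from there.\<close>

lemma cell_of_step:
  assumes "\<not> Suc i < B \<Longrightarrow> fst (snd C) \<le> i"
  shows "cell_of (tm_step M C) i =
    next_cell M (neighbour (0 < i) (i - 1) (cell_of C)) (cell_of C i) (neighbour (Suc i < B) (Suc i) (cell_of C))"
proof -
  obtain q h tape where C: "C = (q, h, tape)" by (cases C)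
  obtain q' b d where act: "action M q (tape h) = (q', b, d)" by (metis surj_pair)
  have left: "leaving M e (cell_of C j) = (if j = h \<and> e = d then Some q' else None)" for e j
    using act by (auto simp: C cell_of_def)
  have "written M (cell_of C j) = (if j = h then b else tape j)" for j
    using act by (auto simp: C cell_of_def)
  moreover have "tm_step M C = (q', move d h, tape(h := b))"
    unfolding C tm_step_action act by simp
  then have "cell_of (tm_step M C) i = (if i = move d h then Some q' else None, if i = h then b else tape i)"
    by (simp add: cell_of_def)
  moreover have "\<not> Suc i < B \<Longrightarrow> h \<le> i" using assms C by simp
  ultimately show ?thesis
    by (cases d; cases i) (auto simp: next_cell_def neighbour_def choice_def left)
qed

lemma head_config: "fst (snd (config M x t)) \<le> t"
proof (induction t)
  case 0
  show ?case by (simp add: config_def tm_init_def)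
next
  case (Suc t)
  obtain q h tape where C: "config M x t = (q, h, tape)" by (cases "config M x t")
  obtain q' b d where act: "action M q (tape h) = (q', b, d)" by (metis surj_pair)
  have "move d h \<le> Suc h" by (cases d) auto
  then show ?case using Suc C act
    by (simp add: config_def tm_step_action del: tm_step.simps)
qed

lemma config_Suc: "config M x (Suc t) = tm_step M (config M x t)"
  by (simp add: config_def)

lemma cell_config_Suc:
  assumes "Suc t < B"
  shows "cell_of (config M x (Suc t)) i =
    next_cell M (neighbour (0 < i) (i - 1) (cell_of (config M x t))) (cell_of (config M x t) i)
      (neighbour (Suc i < B) (Suc i) (cell_of (config M x t)))"
  unfolding config_Suc using head_config[of M x t] assms by (intro cell_of_step) linarith

definition cells :: "tm \<Rightarrow> cell set" where
  "cells M = insert None (Some ` tm_states M) \<times> tm_alphabet M"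

lemma finite_cells: "wf_tm M \<Longrightarrow> finite (cells M)"
  by (simp add: cells_def wf_tm_def)

lemma cell_config_in_cells:
  assumes "wf_tm M"
  shows "cell_of (config M x t) i \<in> cells M"
proof -
  have "fst (config M x t) \<in> tm_states M \<and> (\<forall>i. snd (snd (config M x t)) i \<in> tm_alphabet M)"
  proof (induction t)
    case 0
    show ?case using assms by (auto simp: config_def tm_init_def wf_tm_def) (metis (full_types) subsetD insertCI)
  next
    case (Suc t)
    obtain q h tape where C: "config M x t = (q, h, tape)" by (cases "config M x t")
    obtain q' b d where act: "action M q (tape h) = (q', b, d)" by (metis surj_pair)
    have "q \<in> tm_states M" "\<And>i. tape i \<in> tm_alphabet M" using Suc C by auto
    moreover from this have "tm_delta M q (tape h) \<in> tm_states M \<times> tm_alphabet M \<times> UNIV"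
      using assms unfolding wf_tm_def by blast
    ultimately have "q' \<in> tm_states M" "b \<in> tm_alphabet M"
      using act unfolding action_def by (auto split: if_splits)
    then show ?case using \<open>\<And>i. tape i \<in> tm_alphabet M\<close>
      by (simp add: config_Suc C tm_step_action act del: tm_step.simps)
  qed
  then show ?thesis by (auto simp: cell_of_def cells_def split: prod.splits)
qed

section \<open>The computation tableau as a layered circuit\<close>

datatype kind = Goal | Top | Fact cell | Window "cell option" cell "cell option"

text \<open>A node consists of a time, a cell number and a kind; for \<open>Goal\<close> and \<open>Top\<close> the numbers are irrelevant.\<close>

type_synonym node = "nat \<times> nat \<times> kind"

definition is_top :: "node \<Rightarrow> bool" where
  "is_top = (\<lambda>(t, i, \<kappa>). \<kappa> = Top)"

text \<open>Facts occupy even and windows odd layers. At \<open>2 * B\<close> the output gate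
  \<open>Goal\<close> sits directly above the windows of time \<open>B - 1\<close>.\<close>

definition layer :: "nat \<Rightarrow> node \<Rightarrow> nat" where
  "layer B = (\<lambda>(t, i, \<kappa>). case \<kappa> of Goal \<Rightarrow> 2 * B | Top \<Rightarrow> 0 | Fact c \<Rightarrow> 2 * t | Window l c r \<Rightarrow> Suc (2 * t))"

text \<open>The nodes form a full product and thus include windows of the wrong shape for their
  cell; edges into windows are restricted to the right shape.\<close>

definition fits_at :: "nat \<Rightarrow> nat \<Rightarrow> cell option \<Rightarrow> cell option \<Rightarrow> bool" where
  "fits_at B i l r \<longleftrightarrow> (l = None \<longleftrightarrow> i = 0) \<and> (r = None \<longleftrightarrow> \<not> Suc i < B)"

fun kind_edge :: "tm \<Rightarrow> nat \<Rightarrow> nat \<Rightarrow> kind \<Rightarrow> nat \<Rightarrow> kind \<Rightarrow> bool" where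
  "kind_edge M B i (Fact g) j (Window l c r) \<longleftrightarrow> j = i \<and> fits_at B i l r \<and> next_cell M l c r \<noteq> g"
| "kind_edge M B i (Window l c r) j (Fact g) \<longleftrightarrow>
     j = i \<and> g \<noteq> c \<or> l \<noteq> None \<and> i = Suc j \<and> g \<noteq> the l \<or> r \<noteq> None \<and> j = Suc i \<and> g \<noteq> the r"
| "kind_edge M B i Goal j (Window l c r) \<longleftrightarrow> fits_at B j l r \<and> fst c = Some (tm_reject M)"
| "kind_edge M B i _ j _ \<longleftrightarrow> False"

text \<open>Times are left out: \<open>net_acc\<close> consults edges between adjacent layers only,
  and this fixes the times.\<close>

definition edge :: "tm \<Rightarrow> nat \<Rightarrow> node \<Rightarrow> node \<Rightarrow> bool" where
  "edge M B = (\<lambda>(t, i, \<kappa>) (t', j, \<kappa>'). kind_edge M B i \<kappa> j \<kappa>')"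

definition initially :: "tm \<Rightarrow> bool list \<Rightarrow> node \<Rightarrow> bool" where
  "initially M x = (\<lambda>(t, i, \<kappa>). \<kappa> = Fact (cell_of (tm_init M x) i))"

text \<open>The guards \<open>0 < i\<close> and \<open>Suc i < B\<close> extend the NOR equation to
  windows of the wrong shape: no fact can contradict a neighbour outside the tableau.\<close>

fun kind_value :: "tm \<Rightarrow> bool list \<Rightarrow> nat \<Rightarrow> nat \<Rightarrow> nat \<Rightarrow> kind \<Rightarrow> bool" where
  "kind_value M x B t i (Fact g) \<longleftrightarrow> cell_of (config M x t) i = g"
| "kind_value M x B t i (Window l c r) \<longleftrightarrow> cell_of (config M x t) i = c \<and>
     (l \<noteq> None \<longrightarrow> 0 < i \<longrightarrow> cell_of (config M x t) (i - 1) = the l) \<and>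
     (r \<noteq> None \<longrightarrow> Suc i < B \<longrightarrow> cell_of (config M x t) (Suc i) = the r)"
| "kind_value M x B t i Goal \<longleftrightarrow> (\<forall>j<B. fst (cell_of (config M x (B - 1)) j) \<noteq> Some (tm_reject M))"
| "kind_value M x B t i Top \<longleftrightarrow> True"

definition node_value :: "tm \<Rightarrow> bool list \<Rightarrow> nat \<Rightarrow> node \<Rightarrow> bool" where
  "node_value M x B = (\<lambda>(t, i, \<kappa>). kind_value M x B t i \<kappa>)"

definition kinds :: "tm \<Rightarrow> kind set" where
  "kinds M = {Goal, Top} \<union> Fact ` cells M \<union>
     (\<lambda>(l, c, r). Window l c r) ` (insert None (Some ` cells M) \<times> cells M \<times> insert None (Some ` cells M))"

definition nodes :: "tm \<Rightarrow> nat \<Rightarrow> node set" where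
  "nodes M B = {..<B} \<times> {..<B} \<times> kinds M"

lemma cells_blank: "wf_tm M \<Longrightarrow> (None, Blank) \<in> cells M" "wf_tm M \<Longrightarrow> (None, Bit True) \<in> cells M"
  "wf_tm M \<Longrightarrow> (Some (tm_reject M), Blank) \<in> cells M"
  by (auto simp: cells_def wf_tm_def)

lemma window_in_kinds:
  "c \<in> cells M \<Longrightarrow> (\<And>g. l = Some g \<Longrightarrow> g \<in> cells M) \<Longrightarrow> (\<And>g. r = Some g \<Longrightarrow> g \<in> cells M) \<Longrightarrow>
    Window l c r \<in> kinds M"
  unfolding kinds_def by (cases l; cases r) (auto intro!: image_eqI[where x = "(l, c, r)"])

text \<open>Provides the hypothesis \<open>succ\<close> of \<open>sat_layer_fml\<close>. The inputs
  exhibited need not be true or occur in the run.\<close>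

lemma exists_successor:
  assumes "wf_tm M" "u \<in> nodes M B" "\<not> is_top u" "layer B u = Suc k"
  shows "\<exists>v\<in>nodes M B. \<not> is_top v \<and> layer B v = k \<and> edge M B u v"
proof -
  obtain t i \<kappa> where u: "u = (t, i, \<kappa>)" by (cases u)
  have ti: "t < B" "i < B" using assms(2) u by (auto simp: nodes_def)
  let ?n = "\<lambda>b. if b then Some (None, Blank) else None"
  show ?thesis
  proof (cases \<kappa>)
    case Goal
    have "Window None (Some (tm_reject M), Blank) (?n (1 < B)) \<in> kinds M"
      using cells_blank[OF assms(1)] by (intro window_in_kinds) (auto split: if_splits)
    then show ?thesis using assms(4) ti Goal
      by (intro bexI[of _ "(B - 1, 0, Window None (Some (tm_reject M), Blank) (?n (1 < B)))"])
        (auto simp: u layer_def edge_def is_top_def nodes_def fits_at_def)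
  next
    case (Fact g)
    \<comment> \<open>A window without a head reproduces its middle cell, so it suffices that
      \<open>(None, s)\<close> differs from \<open>g\<close>.\<close>
    define s where "s = (if g = (None, Blank) then Bit True else Blank)"
    let ?w = "Window (?n (0 < i)) (None, s) (?n (Suc i < B))"
    have "?w \<in> kinds M"
      using cells_blank[OF assms(1)] by (intro window_in_kinds) (auto simp: s_def split: if_splits)
    moreover have "next_cell M (?n (0 < i)) (None, s) (?n (Suc i < B)) \<noteq> g"
      by (auto simp: next_cell_def choice_def s_def)
    ultimately show ?thesis using assms(4) ti Fact
      by (intro bexI[of _ "(t - 1, i, ?w)"])
        (auto simp: u layer_def edge_def is_top_def nodes_def fits_at_def)
  next
    case (Window l c r)
    define g :: cell where "g = (if c = (None, Blank) then (None, Bit True) else (None, Blank))"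
    have "Fact g \<in> kinds M" "g \<noteq> c"
      using cells_blank[OF assms(1)] by (auto simp: g_def kinds_def)
    then show ?thesis using assms(4) ti Window
      by (intro bexI[of _ "(t, i, Fact g)"]) (auto simp: u layer_def edge_def is_top_def nodes_def)
  qed (use assms u in \<open>simp add: is_top_def\<close>)
qed

text \<open>Among the windows of the right shape at a given cell and time, exactly the actual one is
  true. A NOR over the windows with some property thus says that the actual window lacks it.\<close>

lemma node_value_nor:
  assumes "wf_tm M" "u \<in> nodes M B" "\<not> is_top u" "layer B u = Suc k"
  shows "node_value M x B u \<longleftrightarrow>
    (\<forall>v\<in>nodes M B. \<not> is_top v \<longrightarrow> layer B v = k \<longrightarrow> edge M B u v \<longrightarrow> \<not> node_value M x B v)"
proof -
  obtain t i \<kappa> where u: "u = (t, i, \<kappa>)" by (cases u)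
  have ti: "t < B" "i < B" using assms(2) u by (auto simp: nodes_def)
  let ?cell = "\<lambda>t. cell_of (config M x t)"
  have actual: "Window (neighbour (0 < i) (i - 1) (?cell t)) (?cell t i) (neighbour (Suc i < B) (Suc i) (?cell t)) \<in> kinds M"
    for t i
    using cell_config_in_cells[OF assms(1)] by (metis window_in_kinds neighbour_SomeD)
  have window: "kind_value M x B t i (Window l c r) \<longleftrightarrow>
      l = neighbour (0 < i) (i - 1) (?cell t) \<and> c = ?cell t i \<and> r = neighbour (Suc i < B) (Suc i) (?cell t)"
    if "fits_at B i l r" for t i l c r
    using that by (cases l; cases r) (auto simp: fits_at_def neighbour_def)
  have fits: "fits_at B i (neighbour (0 < i) j f) (neighbour (Suc i < B) k h)" for i j f k h
    by (auto simp: fits_at_def neighbour_def)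
  have actual_value: "node_value M x B (t, i, Window (neighbour (0 < i) (i - 1) (?cell t)) (?cell t i)
      (neighbour (Suc i < B) (Suc i) (?cell t)))" for t i
    unfolding node_value_def prod.case by (simp only: window[OF fits])
  show ?thesis
  proof (cases \<kappa>)
    case Goal
    have k: "k = Suc (2 * (B - 1))" using assms(4) ti by (auto simp: u layer_def Goal)
    show ?thesis
    proof
      assume "node_value M x B u"
      then have *: "\<forall>j<B. fst (?cell (B - 1) j) \<noteq> Some (tm_reject M)"
        by (simp add: u Goal node_value_def)
      show "\<forall>v\<in>nodes M B. \<not> is_top v \<longrightarrow> layer B v = k \<longrightarrow> edge M B u v \<longrightarrow> \<not> node_value M x B v"
      proof (intro ballI impI notI)
        fix v assume v: "v \<in> nodes M B" "layer B v = k" "edge M B u v" "node_value M x B v"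
        obtain t' j l c r where "v = (t', j, Window l c r)"
          using v(3) by (cases v; cases "snd (snd v)") (auto simp: u Goal edge_def)
        with v k * show False by (auto simp: u Goal edge_def node_value_def nodes_def layer_def)
      qed
    next
      assume *: "\<forall>v\<in>nodes M B. \<not> is_top v \<longrightarrow> layer B v = k \<longrightarrow> edge M B u v \<longrightarrow> \<not> node_value M x B v"
      have "fst (?cell (B - 1) j) \<noteq> Some (tm_reject M)" if "j < B" for j
      proof
        let ?w = "Window (neighbour (0 < j) (j - 1) (?cell (B - 1))) (?cell (B - 1) j)
          (neighbour (Suc j < B) (Suc j) (?cell (B - 1)))"
        assume "fst (?cell (B - 1) j) = Some (tm_reject M)"
        then have "\<not> node_value M x B (B - 1, j, ?w)"
          using *[rule_format, of "(B - 1, j, ?w)"] actual[of j "B - 1"] that k fits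
          by (simp add: u Goal edge_def nodes_def layer_def is_top_def)
        then show False using actual_value by blast
      qed
      then show "node_value M x B u" by (simp add: u Goal node_value_def)
    qed
  next
    case (Fact g)
    obtain t0 where t: "t = Suc t0" and k: "k = Suc (2 * t0)"
      using assms(4) by (cases t) (auto simp: u layer_def Fact)
    let ?w = "Window (neighbour (0 < i) (i - 1) (?cell t0)) (?cell t0 i) (neighbour (Suc i < B) (Suc i) (?cell t0))"
    have step: "?cell t i = next_cell M (neighbour (0 < i) (i - 1) (?cell t0)) (?cell t0 i)
        (neighbour (Suc i < B) (Suc i) (?cell t0))"
      using cell_config_Suc ti t by blast
    show ?thesis
    proof
      assume "node_value M x B u"
      then have *: "?cell t i = g" by (simp add: u Fact node_value_def)
      show "\<forall>v\<in>nodes M B. \<not> is_top v \<longrightarrow> layer B v = k \<longrightarrow> edge M B u v \<longrightarrow> \<not> node_value M x B v"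
      proof (intro ballI impI notI)
        fix v assume v: "v \<in> nodes M B" "layer B v = k" "edge M B u v" "node_value M x B v"
        obtain t' j l c r where v': "v = (t', j, Window l c r)"
          using v(3) by (cases v; cases "snd (snd v)") (auto simp: u Fact edge_def)
        with v k have "t' = t0" "j = i" "fits_at B i l r" "next_cell M l c r \<noteq> g"
          by (auto simp: u Fact edge_def layer_def)
        moreover from this v(4) have "kind_value M x B t0 i (Window l c r)"
          by (simp add: v' node_value_def)
        ultimately show False using window step * by simp
      qed
    next
      assume *: "\<forall>v\<in>nodes M B. \<not> is_top v \<longrightarrow> layer B v = k \<longrightarrow> edge M B u v \<longrightarrow> \<not> node_value M x B v"
      have "?cell t i = g"
      proof (rule ccontr)
        assume "?cell t i \<noteq> g"
        then have "\<not> node_value M x B (t0, i, ?w)"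
          using *[rule_format, of "(t0, i, ?w)"] actual[of i t0] ti t k fits step
          by (simp add: u Fact edge_def nodes_def layer_def is_top_def)
        then show False using actual_value by blast
      qed
      then show "node_value M x B u" by (simp add: u Fact node_value_def)
    qed
  next
    case (Window l c r)
    have k: "k = 2 * t" using assms(4) by (simp add: u Window layer_def)
    \<comment> \<open>In layer \<open>2 * t\<close> the true facts are the actual contents at time
      \<open>t\<close>, so only these can falsify the NOR.\<close>
    have "(\<forall>v\<in>nodes M B. \<not> is_top v \<longrightarrow> layer B v = k \<longrightarrow> edge M B u v \<longrightarrow> \<not> node_value M x B v) \<longleftrightarrow>
        (\<forall>j<B. \<not> kind_edge M B i (Window l c r) j (Fact (?cell t j)))"
    proof (intro iffI allI impI notI ballI)
      fix j
      assume *: "\<forall>v\<in>nodes M B. \<not> is_top v \<longrightarrow> layer B v = k \<longrightarrow> edge M B u v \<longrightarrow> \<not> node_value M x B v"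
        and "j < B" "kind_edge M B i (Window l c r) j (Fact (?cell t j))"
      moreover have "Fact (?cell t j) \<in> kinds M"
        using cell_config_in_cells[OF assms(1)] by (simp add: kinds_def)
      ultimately show False
        using *[rule_format, of "(t, j, Fact (?cell t j))"] ti k
        by (simp add: u Window edge_def nodes_def layer_def is_top_def node_value_def)
    next
      fix v
      assume *: "\<forall>j<B. \<not> kind_edge M B i (Window l c r) j (Fact (?cell t j))"
        and v: "v \<in> nodes M B" "layer B v = k" "edge M B u v" "node_value M x B v"
      obtain t' j g where v': "v = (t', j, Fact g)"
        using v(3) by (cases v; cases "snd (snd v)") (auto simp: u Window edge_def)
      with v k have "t' = t" "g = ?cell t j" "j < B" "kind_edge M B i (Window l c r) j (Fact g)"
        by (auto simp: u Window edge_def layer_def node_value_def nodes_def)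
      with * show False by blast
    qed
    also have "\<dots> \<longleftrightarrow> ?cell t i = c \<and> (\<forall>j<B. l \<noteq> None \<longrightarrow> i = Suc j \<longrightarrow> ?cell t j = the l) \<and>
        (\<forall>j<B. r \<noteq> None \<longrightarrow> j = Suc i \<longrightarrow> ?cell t j = the r)"
      unfolding kind_edge.simps kind.inject using ti(2) by blast
    also have "\<dots> \<longleftrightarrow> node_value M x B u"
      using ti by (cases i) (auto simp: u Window node_value_def)
    finally show ?thesis by simp
  qed (use assms u in \<open>simp add: is_top_def\<close>)
qed

lemma node_value_base:
  assumes "u \<in> nodes M B" "\<not> is_top u" "layer B u = 0"
  shows "node_value M x B u \<longleftrightarrow> initially M x u"
  using assms
  by (cases u; cases "snd (snd u)")
    (auto simp: node_value_def initially_def layer_def is_top_def nodes_def config_def)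

lemma sat_tableau:
  assumes "wf_tm M" "w ` {..<n} = nodes M B" "B > 0" "a < n" "w a = (t, i, Goal)"
  shows "KC_model (net_model n w is_top (layer B) (edge M B) (initially M x))"
    and "sat (net_model n w is_top (layer B) (edge M B) (initially M x)) a (layer_fml (2 * B)) \<longleftrightarrow>
      (\<forall>j<B. fst (cell_of (config M x (B - 1)) j) \<noteq> Some (tm_reject M))"
proof -
  have "(0, 0, Top) \<in> nodes M B" using assms(3) by (simp add: nodes_def kinds_def)
  then obtain c where c: "c < n" "is_top (w c)"
    using assms(2) by (metis (mono_tags, lifting) imageE lessThan_iff is_top_def case_prod_conv)
  then show "KC_model (net_model n w is_top (layer B) (edge M B) (initially M x))"
    by (rule KC_net_model)
  have mem: "\<And>a. a < n \<Longrightarrow> w a \<in> nodes M B" using assms(2) by blast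
  have all: "(\<forall>v\<in>nodes M B. P v) \<longleftrightarrow> (\<forall>b<n. P (w b))" for P using assms(2) by (auto simp flip: assms(2))
  have ex: "(\<exists>v\<in>nodes M B. P v) \<longleftrightarrow> (\<exists>b<n. P (w b))" for P using assms(2) by (auto simp flip: assms(2))
  have "sat (net_model n w is_top (layer B) (edge M B) (initially M x)) a (layer_fml (2 * B)) \<longleftrightarrow>
      node_value M x B (w a)"
  proof (rule sat_layer_fml[where apex = is_top and w = w, OF c])
    show "node_value M x B (w a) \<longleftrightarrow> initially M x (w a)" if "a < n" "\<not> is_top (w a)" "layer B (w a) = 0" for a
      using node_value_base mem that by blast
    show "node_value M x B (w a) \<longleftrightarrow> (\<forall>b<n. \<not> is_top (w b) \<longrightarrow> layer B (w b) = l \<longrightarrow>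
        edge M B (w a) (w b) \<longrightarrow> \<not> node_value M x B (w b))"
      if "a < n" "\<not> is_top (w a)" "layer B (w a) = Suc l" for a l
      using node_value_nor[OF assms(1) mem[OF that(1)] that(2,3)] unfolding all .
    show "\<exists>b<n. \<not> is_top (w b) \<and> layer B (w b) = l \<and> edge M B (w a) (w b)"
      if "a < n" "\<not> is_top (w a)" "layer B (w a) = Suc l" for a l
      using exists_successor[OF assms(1) mem[OF that(1)] that(2,3)] unfolding ex .
  qed (use assms(4,5) in \<open>auto simp: is_top_def layer_def\<close>)
  then show "sat (net_model n w is_top (layer B) (edge M B) (initially M x)) a (layer_fml (2 * B)) \<longleftrightarrow>
      (\<forall>j<B. fst (cell_of (config M x (B - 1)) j) \<noteq> Some (tm_reject M))"
    by (simp add: assms(5) node_value_def)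
qed

text \<open>A halted machine keeps its configuration, so time \<open>B - 1\<close> still shows the
  verdict, and the head is then on one of the first \<open>B\<close> cells. Acceptance is expressed
  as absence of rejection to match a NOR gate at the output.\<close>

lemma decides_iff_not_rejecting:
  assumes "wf_tm M" "tm_decides_in_time M A T" "T (length x) < B"
  shows "x \<in> A \<longleftrightarrow> (\<forall>j<B. fst (cell_of (config M x (B - 1)) j) \<noteq> Some (tm_reject M))"
proof -
  define C where "C = config M x (T (length x))"
  have dec: "fst C = (if x \<in> A then tm_accept M else tm_reject M)"
    using assms(2) by (simp add: C_def config_def tm_decides_in_time_def)
  have "tm_step M C = C" using dec by (cases C) (auto split: if_splits)
  then have halted: "config M x (T (length x) + k) = C" for k
    by (induction k) (simp_all add: C_def config_Suc)
  have "config M x (B - 1) = C" using halted[of "B - 1 - T (length x)"] assms(3) by simp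
  moreover have "fst (snd (config M x (B - 1))) < B"
    using head_config[of M x "B - 1"] assms(3) by linarith
  moreover have "tm_accept M \<noteq> tm_reject M" using assms(1) by (simp add: wf_tm_def)
  ultimately show ?thesis using dec by (cases C) (auto simp: cell_of_def)
qed

section \<open>Writing down the instance\<close>

primrec seqs :: "prog list \<Rightarrow> prog" where
  "seqs [] = Nop"
| "seqs (p # ps) = Then p (seqs ps)"

lemma emits_seqs [simp]: "emits x B e (seqs ps) = concat (map (emits x B e) ps)"
  by (induction ps) auto

lemma scoped_seqs [simp]: "scoped (seqs ps) U \<longleftrightarrow> (\<forall>p\<in>set ps. scoped p U)"
  by (induction ps) auto

definition bits :: "bool list \<Rightarrow> prog" where
  "bits bs = seqs (map Emit bs)"

lemma emits_bits [simp]: "emits x B e (bits bs) = bs"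
  by (induction bs) (auto simp: bits_def)

lemma scoped_bits [simp]: "scoped (bits bs) U"
  by (auto simp: bits_def)

definition bit_of :: "cond \<Rightarrow> prog" where
  "bit_of c = Choose c (Emit True) (Emit False)"

lemma emits_bit_of [simp]: "emits x B e (bit_of c) = [cond_val x B e c]"
  by (simp add: bit_of_def)

lemma scoped_bit_of [simp]: "scoped (bit_of c) U \<longleftrightarrow> cond_vars c \<subseteq> U"
  by (simp add: bit_of_def)

text \<open>Times and cells are run through by loops, whereas the kinds, whose number depends on the
  machine only, are unrolled in the program text. So \<open>P\<close> may inspect the kind when the
  program is built.\<close>

definition node_loop :: "kind list \<Rightarrow> nat \<Rightarrow> nat \<Rightarrow> (kind \<Rightarrow> prog) \<Rightarrow> prog" where
  "node_loop ks u v P = For u (For v (seqs (map P ks)))"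

lemma scoped_node_loop [simp]:
  "scoped (node_loop ks u v P) U \<longleftrightarrow>
     u \<notin> U \<and> v \<noteq> u \<and> v \<notin> U \<and> (\<forall>\<kappa>\<in>set ks. scoped (P \<kappa>) (insert v (insert u U)))"
  by (auto simp: node_loop_def)

text \<open>World numbers in mixed radix, in the order in which \<open>node_loop\<close> visits the
  nodes: the time is the leading digit, the kind the last.\<close>

definition node :: "kind list \<Rightarrow> nat \<Rightarrow> nat \<Rightarrow> node" where
  "node ks B a = (a div length ks div B, a div length ks mod B, ks ! (a mod length ks))"

lemma concat_map_upt_mult:
  "concat (map g [0..<B * K]) = concat (map (\<lambda>i. concat (map (\<lambda>j. g (i * K + j)) [0..<K])) [0..<B])"
proof (induction B)
  case (Suc B)
  have "[0..<Suc B * K] = [0..<B * K] @ [B * K..<K + B * K]"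
    using upt_add_eq_append[of 0 "B * K" K] by (simp add: add.commute)
  also have "[B * K..<K + B * K] = map (\<lambda>j. B * K + j) [0..<K]"
    unfolding map_add_upt[symmetric] by (simp only: add.commute)
  finally have "map g [0..<Suc B * K] = map g [0..<B * K] @ map (\<lambda>j. g (B * K + j)) [0..<K]"
    by (simp only: map_append map_map o_def)
  then show ?case using Suc by (simp del: mult_Suc)
qed simp

lemma digit_bound:
  fixes t :: nat
  assumes "t < m" "i < b"
  shows "t * b + i < m * b"
proof -
  have "t * b + i < Suc t * b" using assms(2) by simp
  also have "\<dots> \<le> m * b" using assms(1) by (intro mult_le_mono1) simp
  finally show ?thesis .
qed

lemma node_index:
  assumes "i < B" "j < length ks"
  shows "node ks B ((t * B + i) * length ks + j) = (t, i, ks ! j)"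
proof -
  have "(q * b + r) div b = q \<and> (q * b + r) mod b = r" if "r < b" for q b r :: nat
    using that div_mult_self3[of b q r] by auto
  from this[OF assms(1)] this[OF assms(2)] show ?thesis
    unfolding node_def by simp
qed

text \<open>Merges the three enumerations into one by world number, so two such loops, one inside
  the other, write a matrix row by row.\<close>

lemma emits_node_loop:
  "emits x B e (node_loop ks u v P) = concat (map (\<lambda>a. case node ks B a of (t, i, \<kappa>) \<Rightarrow>
     emits x B (e(u := t, v := i)) (P \<kappa>)) [0..<B * B * length ks])"
proof -
  let ?K = "length ks"
  let ?g = "\<lambda>t i \<kappa>. emits x B (e(u := t, v := i)) (P \<kappa>)"
  let ?G = "\<lambda>a. case node ks B a of (t, i, \<kappa>) \<Rightarrow> ?g t i \<kappa>"
  define H where "H a = concat (map (\<lambda>j. ?G (a * ?K + j)) [0..<?K])" for a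
  have H: "concat (map (?g t i) ks) = H (t * B + i)" if "i < B" for t i
  proof -
    have "map (?g t i) ks = map (\<lambda>j. ?g t i (ks ! j)) [0..<?K]"
      by (rule nth_equalityI) simp_all
    also have "\<dots> = map (\<lambda>j. ?G ((t * B + i) * ?K + j)) [0..<?K]"
      using that by (intro map_cong) (auto simp: node_index)
    finally show ?thesis by (simp only: H_def)
  qed
  have "emits x B e (node_loop ks u v P) =
      concat (map (\<lambda>t. concat (map (\<lambda>i. concat (map (?g t i) ks)) [0..<B])) [0..<B])"
    by (simp add: node_loop_def o_def)
  also have "\<dots> = concat (map (\<lambda>t. concat (map (\<lambda>i. H (t * B + i)) [0..<B])) [0..<B])"
    by (intro arg_cong[of _ _ concat] map_cong refl H) simp
  also have "\<dots> = concat (map H [0..<B * B])"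
    by (rule concat_map_upt_mult[symmetric])
  also have "\<dots> = concat (map ?G [0..<B * B * ?K])"
    unfolding H_def by (rule concat_map_upt_mult[symmetric])
  finally show ?thesis .
qed

lemma image_node: "node ks B ` {..<B * B * length ks} = {..<B} \<times> {..<B} \<times> set ks"
proof (intro equalityI subsetI)
  fix u assume "u \<in> node ks B ` {..<B * B * length ks}"
  then obtain a where a: "a < B * B * length ks" "u = node ks B a" by auto
  then have K: "0 < length ks" "0 < B" by (auto intro!: gr0I)
  have "a div length ks < B * B" using a(1) by (simp add: less_mult_imp_div_less)
  then show "u \<in> {..<B} \<times> {..<B} \<times> set ks"
    using K a(2) by (auto simp: node_def less_mult_imp_div_less)
next
  fix u assume "u \<in> {..<B} \<times> {..<B} \<times> set ks"
  then obtain t i j where u: "u = (t, i, ks ! j)" "t < B" "i < B" "j < length ks"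
    by (auto simp: in_set_conv_nth)
  have "t * B + i < B * B"
    using digit_bound[OF u(2,3)] .
  then have "(t * B + i) * length ks + j < B * B * length ks"
    using digit_bound[OF _ u(4)] by blast
  moreover have "node ks B ((t * B + i) * length ks + j) = u"
    using u by (simp only: node_index)
  ultimately show "u \<in> node ks B ` {..<B * B * length ks}" by force
qed

section \<open>Accessibility and valuation as loop conditions\<close>

text \<open>
  In the conditions below, the source node of an edge has time and cell in the variables 0 and 1, and
  its target, or the node whose valuation is tabulated, in the variables 2 and 3.
\<close>

definition Eq :: "trm \<Rightarrow> trm \<Rightarrow> cond" where
  "Eq a b = Con (Neg (Lt a b)) (Neg (Lt b a))"

definition Dis :: "cond \<Rightarrow> cond \<Rightarrow> cond" where
  "Dis c d = Neg (Con (Neg c) (Neg d))"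

definition fits_cond :: "nat \<Rightarrow> cell option \<Rightarrow> cell option \<Rightarrow> cond" where
  "fits_cond v l r =
     Con (if l = None then Neg (Lt Zero (V v)) else Lt Zero (V v))
       (if r = None then Neg (Lt (VS v) Bound) else Lt (VS v) Bound)"

lemma cond_val_abbrevs [simp]:
  "cond_val x B e (Eq a b) \<longleftrightarrow> trm_val B e a = trm_val B e b"
  "cond_val x B e (Dis c d) \<longleftrightarrow> cond_val x B e c \<or> cond_val x B e d"
  "cond_val x B e (fits_cond v l r) \<longleftrightarrow> fits_at B (e v) l r"
  by (auto simp: Eq_def Dis_def fits_cond_def fits_at_def)

lemma cond_vars_abbrevs [simp]:
  "cond_vars (Eq a b) = trm_vars a \<union> trm_vars b"
  "cond_vars (Dis c d) = cond_vars c \<union> cond_vars d"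
  "cond_vars (fits_cond v l r) = {v}"
  by (auto simp: Eq_def Dis_def fits_cond_def)

text \<open>The inequality between layers restated for times, which is all that the loop variables
  provide. The parity of the layers decides where a successor appears.\<close>

fun far_cond :: "kind \<Rightarrow> kind \<Rightarrow> cond" where
  "far_cond Goal (Fact g) = Const True"
| "far_cond Goal (Window l c r) = Lt (VS 2) Bound"
| "far_cond (Fact g) (Window l c r) = Lt (VS 2) (V 0)"
| "far_cond \<kappa> Goal = Const False"
| "far_cond \<kappa> \<kappa>' = Lt (V 2) (V 0)"

fun near_cond :: "tm \<Rightarrow> kind \<Rightarrow> kind \<Rightarrow> cond" where
  "near_cond M (Fact g) (Window l c r) =
     Con (Con (Eq (V 0) (VS 2)) (Eq (V 1) (V 3)))
       (Con (fits_cond 1 l r) (Const (next_cell M l c r \<noteq> g)))"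
| "near_cond M (Window l c r) (Fact g) =
     Con (Eq (V 0) (V 2))
       (Dis (Con (Eq (V 3) (V 1)) (Const (g \<noteq> c)))
         (Dis (Con (Eq (V 1) (VS 3)) (Const (l \<noteq> None \<and> g \<noteq> the l)))
           (Con (Eq (V 3) (VS 1)) (Const (r \<noteq> None \<and> g \<noteq> the r)))))"
| "near_cond M Goal (Window l c r) =
     Con (Neg (Lt (VS 2) Bound)) (Con (fits_cond 3 l r) (Const (fst c = Some (tm_reject M))))"
| "near_cond M \<kappa> \<kappa>' = Const False"

definition acc_cond :: "tm \<Rightarrow> kind \<Rightarrow> kind \<Rightarrow> cond" where
  "acc_cond M \<kappa> \<kappa>' =
     (if \<kappa>' = Top then Const True else if \<kappa> = Top then Const False
      else Dis (Con (Const (\<kappa> = \<kappa>')) (Con (Eq (V 0) (V 2)) (Eq (V 1) (V 3))))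
        (Dis (far_cond \<kappa> \<kappa>') (near_cond M \<kappa> \<kappa>')))"

lemma cond_val_acc_cond:
  assumes "e 0 < B" "e 2 < B"
  shows "cond_val x B e (acc_cond M \<kappa> \<kappa>') \<longleftrightarrow>
    net_acc is_top (layer B) (edge M B) (e 0, e 1, \<kappa>) (e 2, e 3, \<kappa>')"
proof (cases "\<kappa> = Top \<or> \<kappa>' = Top")
  case True
  then show ?thesis by (auto simp: acc_cond_def net_acc_def is_top_def)
next
  case False
  have far: "cond_val x B e (far_cond \<kappa> \<kappa>') \<longleftrightarrow> layer B (e 2, e 3, \<kappa>') + 2 \<le> layer B (e 0, e 1, \<kappa>)"
    using assms False by (cases \<kappa>; cases \<kappa>') (auto simp: layer_def)
  have near: "cond_val x B e (near_cond M \<kappa> \<kappa>') \<longleftrightarrow>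
      layer B (e 0, e 1, \<kappa>) = Suc (layer B (e 2, e 3, \<kappa>')) \<and> edge M B (e 0, e 1, \<kappa>) (e 2, e 3, \<kappa>')"
  proof -
    have "2 * a \<noteq> Suc (2 * b)" "Suc (2 * b) \<noteq> 2 * a" for a b :: nat by presburger+
    then show ?thesis
      using assms False by (cases \<kappa>; cases \<kappa>') (auto simp: layer_def edge_def)
  qed
  show ?thesis using False far near by (auto simp: acc_cond_def net_acc_def is_top_def)
qed

lemma cond_vars_acc_cond: "cond_vars (acc_cond M \<kappa> \<kappa>') \<subseteq> {0, 1, 2, 3}"
  by (cases \<kappa>; cases \<kappa>') (auto simp: acc_cond_def)

text \<open>\<open>In\<close> fails beyond the input for both bits, which is how a blank is
  recognised.\<close>

definition symbol_cond :: "symbol \<Rightarrow> cond" where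
  "symbol_cond a = (case a of Blank \<Rightarrow> Con (Neg (In True 3)) (Neg (In False 3)) | Bit b \<Rightarrow> In b 3 | Aux m \<Rightarrow> Const False)"

fun init_cond :: "tm \<Rightarrow> kind \<Rightarrow> cond" where
  "init_cond M Top = Const True"
| "init_cond M (Fact (s, a)) =
     Con (Con (Neg (Lt Zero (V 2))) (symbol_cond a))
       (case s of None \<Rightarrow> Lt Zero (V 3) | Some q \<Rightarrow> Con (Const (q = tm_start M)) (Neg (Lt Zero (V 3))))"
| "init_cond M \<kappa> = Const False"

lemma cond_val_init_cond:
  assumes "B > 0"
  shows "cond_val x B e (init_cond M \<kappa>) \<longleftrightarrow>
    net_val is_top (layer B) (initially M x) 0 (e 2, e 3, \<kappa>)"
proof -
  have "cond_val x B e (symbol_cond a) \<longleftrightarrow> (if e 3 < length x then Bit (x ! e 3) else Blank) = a" for a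
    by (cases a) (auto simp: symbol_cond_def)
  then show ?thesis
    using assms by (cases "(M, \<kappa>)" rule: init_cond.cases)
      (auto simp: net_val_def is_top_def layer_def initially_def cell_of_def tm_init_def split: option.splits)
qed

lemma cond_vars_init_cond: "cond_vars (init_cond M \<kappa>) \<subseteq> {2, 3}"
  by (cases "(M, \<kappa>)" rule: init_cond.cases)
    (auto simp: symbol_cond_def split: option.splits symbol.splits)

text \<open>Membership in the valuation of \<open>p\<^sub>l\<close>, where \<open>l = 2 v\<^sub>0 + b\<close> and \<open>v\<^sub>0\<close> is the value of variable 0.\<close>

fun below_cond :: "bool \<Rightarrow> kind \<Rightarrow> cond" where
  "below_cond b Goal = Const False"
| "below_cond b Top = Const True"
| "below_cond b (Fact g) = (if b then Neg (Lt (V 0) (V 2)) else Lt (V 2) (V 0))"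
| "below_cond b (Window l c r) = Lt (V 2) (V 0)"

lemma cond_val_below_cond:
  assumes "e 0 < B"
  shows "cond_val x B e (below_cond b \<kappa>) \<longleftrightarrow>
    net_val is_top (layer B) Q (Suc (2 * e 0 + of_bool b)) (e 2, e 3, \<kappa>)"
  using assms by (cases \<kappa>) (auto simp: net_val_def is_top_def layer_def)

lemma cond_vars_below_cond: "cond_vars (below_cond b \<kappa>) \<subseteq> {0, 2}"
  by (cases \<kappa>) auto

section \<open>The program that writes the instance\<close>

definition twice_prog :: prog where
  "twice_prog = For 1 (Choose (Lt (V 1) (V 0)) (bits [True, True]) Nop)"

lemma concat_map_True_True: "concat (map (\<lambda>_. [True, True]) [0..<t]) = replicate (2 * t) True"
  by (induction t) (simp_all add: replicate_app_Cons_same)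

lemma emits_twice_prog:
  assumes "e 0 \<le> B"
  shows "emits x B e twice_prog = replicate (2 * e 0) True"
proof -
  let ?f = "\<lambda>i. if i < e 0 then [True, True] else []"
  obtain d where d: "B = e 0 + d" using assms le_Suc_ex by blast
  have maps: "map ?f [0..<e 0] = map (\<lambda>_. [True, True]) [0..<e 0]"
    "map ?f [e 0..<e 0 + d] = map (\<lambda>_. []) [e 0..<e 0 + d]"
    by auto
  have "concat (map ?f [0..<B]) = concat (map (\<lambda>_. [True, True]) [0..<e 0])"
    unfolding d upt_add_eq_append[OF le0] map_append concat_append maps by simp
  then show ?thesis by (simp add: twice_prog_def concat_map_True_True cong: if_cong)
qed

text \<open>The order is that of \<open>enc_instance\<close>: formula, worlds, accessibility, number
  of variables, valuation, state. As loops stop at \<open>B\<close>, each round treats two of the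
  \<open>2 * B\<close> layers.\<close>

definition reduction_prog :: "tm \<Rightarrow> kind list \<Rightarrow> prog" where
  "reduction_prog M ks = seqs
     [For 0 (bits [True, False, False, True, False, False]), bits [False, False, True, False],
      For 0 (seqs [bits [False, False, True], twice_prog, bits [True, False],
        bits [False, False, True], twice_prog, bits [True, True, False]]),
      node_loop ks 0 1 (\<lambda>_. bits [True]), bits [False],
      node_loop ks 0 1 (\<lambda>\<kappa>. node_loop ks 2 3 (\<lambda>\<kappa>'. bit_of (acc_cond M \<kappa> \<kappa>'))),
      bits [True], For 0 (bits [True, True]), bits [False],
      node_loop ks 2 3 (\<lambda>\<kappa>. bit_of (init_cond M \<kappa>)),
      For 0 (seqs [node_loop ks 2 3 (\<lambda>\<kappa>. bit_of (below_cond False \<kappa>)),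
        node_loop ks 2 3 (\<lambda>\<kappa>. bit_of (below_cond True \<kappa>))]),
      bits [False]]"

lemma scoped_reduction_prog: "scoped (reduction_prog M ks) {}"
  using cond_vars_acc_cond cond_vars_init_cond cond_vars_below_cond
  by (fastforce simp: reduction_prog_def twice_prog_def)

lemma concat_map_upt_double:
  "concat (map g [0..<2 * B]) = concat (map (\<lambda>t. g (2 * t) @ g (Suc (2 * t))) [0..<B])"
  by (induction B) auto

text \<open>The implications nest to the left, so in prefix notation all their tags come first and
  the variables follow in increasing order; plain loops can write this.\<close>

lemma enc_layer_fml:
  "enc_fml (layer_fml l) = concat (map (\<lambda>_. [True, False, False]) [0..<l]) @ [False, False, True, False] @
     concat (map (\<lambda>i. [False, False, True] @ enc_nat (Suc i)) [0..<l])"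
proof (induction l)
  case 0
  show ?case by (simp add: enc_nat_def)
next
  case (Suc l)
  have "[True, False, False] @ concat (map (\<lambda>_. [True, False, False]) [0..<l]) =
      concat (map (\<lambda>_. [True, False, False]) [0..<Suc l])"
    by (induction l) auto
  then show ?case using Suc by simp
qed

lemma enc_table_Suc: "enc_table (Suc r) c f = map (f 0) [0..<c] @ enc_table r c (\<lambda>i. f (Suc i))"
  by (simp add: enc_table_def upt_conv_Cons map_Suc_upt[symmetric] o_def del: upt_Suc)

lemma emits_reduction_prog:
  fixes ks :: "kind list" and B :: nat
  defines "n \<equiv> B * B * length ks"
  assumes "B > 0"
  shows "emits x B e (reduction_prog M ks) =
    enc_instance (layer_fml (2 * B)) n (Suc (2 * B))
      (net_model n (node ks B) is_top (layer B) (edge M B) (initially M x)) 0"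
proof -
  let ?M = "net_model n (node ks B) is_top (layer B) (edge M B) (initially M x)"
  have node: "fst (node ks B a) < B" if "a < n" for a
  proof -
    have "node ks B a \<in> {..<B} \<times> {..<B} \<times> set ks"
      using that unfolding n_def image_node[symmetric] by blast
    then show ?thesis by (simp add: mem_Times_iff)
  qed
  have nat1: "enc_nat (Suc (2 * t)) = replicate (2 * t) True @ [True, False]" for t
    by (simp add: enc_nat_def replicate_append_same flip: append_Cons)
  have nat2: "enc_nat (Suc (Suc (2 * t))) = replicate (2 * t) True @ [True, True, False]" for t
    by (simp add: enc_nat_def replicate_app_Cons_same)
  have twice: "emits x B (e(0 := t)) twice_prog = replicate (2 * t) True" if "t < B" for t
    using emits_twice_prog[of "e(0 := t)" B x] that by simp
  have fml: "enc_fml (layer_fml (2 * B)) =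
      emits x B e (seqs [For 0 (bits [True, False, False, True, False, False]), bits [False, False, True, False],
      For 0 (seqs [bits [False, False, True], twice_prog, bits [True, False],
        bits [False, False, True], twice_prog, bits [True, True, False]])])"
  proof -
    have "concat (map (\<lambda>t. ([False, False, True] @ enc_nat (Suc (2 * t))) @
        ([False, False, True] @ enc_nat (Suc (Suc (2 * t))))) [0..<B]) =
      emits x B e (For 0 (seqs [bits [False, False, True], twice_prog, bits [True, False],
        bits [False, False, True], twice_prog, bits [True, True, False]]))"
      unfolding emits.simps
      by (intro arg_cong[of _ _ concat] map_cong refl) (simp add: nat1 nat2 twice)
    then show ?thesis by (simp add: enc_layer_fml concat_map_upt_double del: emits_seqs)
  qed
  have size: "enc_nat n = emits x B e (seqs [node_loop ks 0 1 (\<lambda>_. bits [True]), bits [False]])"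
    by (simp add: enc_nat_def emits_node_loop n_def case_prod_unfold map_replicate_const)
  have table: "enc_table n n (\<lambda>a b. (a, b) \<in> acc ?M) =
      emits x B e (node_loop ks 0 1 (\<lambda>\<kappa>. node_loop ks 2 3 (\<lambda>\<kappa>'. bit_of (acc_cond M \<kappa> \<kappa>'))))"
    unfolding enc_table_def emits_node_loop n_def[symmetric]
    by (intro arg_cong[of _ _ concat] map_cong refl)
      (auto simp: net_model_def case_prod_unfold cond_val_acc_cond node)
  have rows: "map (\<lambda>a. a \<in> val ?M p) [0..<n] = emits x B e (node_loop ks 2 3 (\<lambda>\<kappa>. bit_of (C \<kappa>)))"
    if "\<And>t i \<kappa>. cond_val x B (e(2 := t, 3 := i)) (C \<kappa>) \<longleftrightarrow>
      net_val is_top (layer B) (initially M x) p (t, i, \<kappa>)" for p e C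
    by (auto simp: emits_node_loop n_def[symmetric] that net_model_def case_prod_unfold)
  have vals: "enc_table (Suc (2 * B)) n (\<lambda>p a. a \<in> val ?M p) =
      emits x B e (seqs [node_loop ks 2 3 (\<lambda>\<kappa>. bit_of (init_cond M \<kappa>)),
      For 0 (seqs [node_loop ks 2 3 (\<lambda>\<kappa>. bit_of (below_cond False \<kappa>)),
        node_loop ks 2 3 (\<lambda>\<kappa>. bit_of (below_cond True \<kappa>))])])"
  proof -
    have "map (\<lambda>a. a \<in> val ?M 0) [0..<n] = emits x B e (node_loop ks 2 3 (\<lambda>\<kappa>. bit_of (init_cond M \<kappa>)))"
      using cond_val_init_cond[OF assms(2)] by (intro rows) simp
    moreover have "map (\<lambda>a. a \<in> val ?M (Suc (2 * t + of_bool b))) [0..<n] =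
        emits x B (e(0 := t)) (node_loop ks 2 3 (\<lambda>\<kappa>. bit_of (below_cond b \<kappa>)))" if "t < B" for t b
      using that by (intro rows) (subst cond_val_below_cond, simp_all)
    from this[where b = False] this[where b = True]
    have "concat (map (\<lambda>t. map (\<lambda>a. a \<in> val ?M (Suc (2 * t))) [0..<n] @
        map (\<lambda>a. a \<in> val ?M (Suc (Suc (2 * t)))) [0..<n]) [0..<B]) =
      emits x B e (For 0 (seqs [node_loop ks 2 3 (\<lambda>\<kappa>. bit_of (below_cond False \<kappa>)),
        node_loop ks 2 3 (\<lambda>\<kappa>. bit_of (below_cond True \<kappa>))]))"
      unfolding emits.simps by (intro arg_cong[of _ _ concat] map_cong refl) simp
    ultimately show ?thesis
      unfolding enc_table_Suc by (simp add: enc_table_def concat_map_upt_double)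
  qed
  have "enc_nat (Suc (2 * B)) = emits x B e (seqs [bits [True], For 0 (bits [True, True]), bits [False]])"
    by (simp add: enc_nat_def concat_map_True_True)
  then show ?thesis
    unfolding enc_instance_def fml size table vals
    by (simp add: reduction_prog_def enc_nat_def[of 0])
qed

text \<open>\<open>c\<close> absorbs the constant factor and the finitely many arguments where the
  estimate may fail; the constant costs one more factor \<open>n + c\<close>, hence the exponent
  \<open>Suc k\<close>.\<close>

lemma polynomial_bound:
  fixes T :: "nat \<Rightarrow> nat"
  assumes "(\<lambda>n. real (T n)) \<in> O(\<lambda>n. real n ^ k)"
  obtains c where "\<And>n. T n < (n + c) ^ Suc k"
proof -
  obtain C where "\<forall>\<^sub>F n in sequentially. norm (real (T n)) \<le> C * norm (real n ^ k)"
    using assms by (auto elim!: landau_o.bigE)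
  then obtain N where N: "\<And>n. n \<ge> N \<Longrightarrow> real (T n) \<le> C * real n ^ k"
    by (auto simp: eventually_sequentially)
  define c where "c = nat \<lceil>C\<rceil> + (\<Sum>n<N. T n) + 1"
  have "T n < (n + c) ^ Suc k" for n
  proof (cases "n < N")
    case True
    then have "T n \<le> (\<Sum>n<N. T n)" by (intro member_le_sum) auto
    also have "\<dots> < n + c" by (simp add: c_def)
    also have "\<dots> \<le> (n + c) ^ Suc k" by (intro self_le_power) (auto simp: c_def)
    finally show ?thesis .
  next
    case False
    then have "real (T n) \<le> C * real n ^ k" using N by simp
    also have "\<dots> \<le> real (nat \<lceil>C\<rceil>) * real n ^ k" by (intro mult_right_mono) (linarith, simp)
    finally have "T n \<le> nat \<lceil>C\<rceil> * n ^ k"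
      by (metis of_nat_le_iff of_nat_mult of_nat_power)
    also have "\<dots> \<le> nat \<lceil>C\<rceil> * (n + c) ^ k" by (intro mult_left_mono power_mono) auto
    also have "\<dots> < (n + c) * (n + c) ^ k" by (intro mult_strict_right_mono) (auto simp: c_def)
    finally show ?thesis by simp
  qed
  then show thesis using that by blast
qed

theorem theorem3p1:
  shows "P_hard KC_imp_model_checking"
  unfolding P_hard_def
proof
  fix A assume "A \<in> class_P"
  then obtain M T k where M: "wf_tm M" "tm_decides_in_time M A T"
    and T: "(\<lambda>n. real (T n)) \<in> O(\<lambda>n. real n ^ k)"
    by (auto simp: class_P_def)
  obtain c where c: "\<And>n. T n < (n + c) ^ Suc k" using polynomial_bound[OF T] by blast
  have "finite (kinds M)" using finite_cells[OF M(1)] by (simp add: kinds_def)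
  then obtain ks0 where ks0: "set ks0 = kinds M" using finite_list by blast
  \<comment> \<open>With \<open>Goal\<close> in front, world 0 is a goal node, which is the state
    that the program writes. \<open>Goal\<close> is thereby listed twice, as the enumeration of
    nodes need not be injective.\<close>
  define ks where "ks = Goal # ks0"
  have ks: "set ks = kinds M" using ks0 by (auto simp: ks_def kinds_def)
  define f where "f x = emits x ((length x + c) ^ Suc k) (\<lambda>_. 0) (reduction_prog M ks)" for x
  have "logspace_computable f"
    unfolding f_def by (intro emits_logspace_computable scoped_reduction_prog) simp
  moreover have "x \<in> A \<longleftrightarrow> f x \<in> KC_imp_model_checking" for x
  proof -
    define B where "B = (length x + c) ^ Suc k"
    have T: "T (length x) < B" unfolding B_def by (rule c)
    then have "B > 0" by simp
    define n where "n = B * B * length ks"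
    let ?N = "net_model n (node ks B) is_top (layer B) (edge M B) (initially M x)"
    have f: "f x = enc_instance (layer_fml (2 * B)) n (Suc (2 * B)) ?N 0"
      unfolding f_def B_def[symmetric] n_def using \<open>B > 0\<close> by (rule emits_reduction_prog)
    have image: "node ks B ` {..<n} = nodes M B"
      unfolding n_def image_node ks nodes_def ..
    have "0 < n" using \<open>B > 0\<close> by (simp add: n_def ks_def)
    moreover have "node ks B 0 = (0, 0, Goal)" by (simp add: node_def ks_def)
    ultimately have KC: "KC_model ?N"
      and sat: "sat ?N 0 (layer_fml (2 * B)) \<longleftrightarrow>
        (\<forall>j<B. fst (cell_of (config M x (B - 1)) j) \<noteq> Some (tm_reject M))"
      using sat_tableau[OF M(1) image \<open>B > 0\<close>] by blast+
    have "valid_instance (layer_fml (2 * B)) n (Suc (2 * B)) ?N 0"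
      using KC \<open>0 < n\<close>
      by (auto simp: valid_instance_def implicational_layer_fml vars_layer_fml net_model_def)
    then show ?thesis
      using enc_instance_in_model_checking_iff decides_iff_not_rejecting[OF M T] sat f by simp
  qed
  ultimately show "logspace_reducible A KC_imp_model_checking"
    unfolding logspace_reducible_def by blast
qed

end
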